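(* Let $X$ be any simplicial complex of dimension $d$. Then: (a) For $0\leq j\leq d$, $\sum_{i=0}^{j}(-1)^{j-i}\mu_i(X)\geq\sum_{i=0}^{j}(-1)^{j-i}\beta_i(X)$, with equality for $j=d$. (b) For each index $j$ with $0\le j\le d$, equality holds in (a) for $j$ if and only if for every induced subcomplex $Y$ of $X$ the morphism $H_j(Y)\to H_j(X)$ induced by the inclusion map $Y\to X$ is injective. (c) For $0\leq j\leq d$, $\mu_j(X)\geq\beta_j(X)$. (d) For each index $j$ with $0\le j\le d$, equality holds in (c) for $j$ if and only if for every induced subcomplex $Y$ of $X$ the two morphisms $H_{j-1}(Y)\to H_{j-1}(X)$ and $H_j(Y)\to H_j(X)$ induced by the inclusion map $Y\to X$ are both injective.
   Context: All simplicial complexes are finite and abstract, and the empty set is a face (of dimension $-1$) of every simplicial complex. A field $\mathbb{F}$ is fixed; $H_*$ is (unreduced) simplicial homology with coefficients in $\mathbb{F}$ (so $H_{-1}=0$) and $\beta_i(X)=\dim_{\mathbb F}H_i(X)$. $V(X)$ is the vertex set of $X$; for any set $A$, $X[A]=\{\alpha\in X:\alpha\subseteq A\}$; the induced subcomplexes of $X$ are the $X[A]$. $f_0(X)$ is the number of vertices of $X$. For $x\in V(X)$, the link of $x$ in $X$ is $\mathrm{lk}(x,X)=\{\alpha: x\notin\alpha,\ \alpha\sqcup\{x\}\in X\}$. Sigma- and mu-vectors. Reduced Betti numbers: $\tilde\beta_0(X)=\beta_0(X)-1$ (so $\tilde\beta_0(\{\emptyset\})=-1$) and $\tilde\beta_i(X)=\beta_i(X)$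 for $i\ge1$. For a simplicial complex $X$ of dimension $d$, put $\sigma_i(X)=\sum_{A\subseteq V(X)}\tilde\beta_i(X[A])\big/\binom{f_0(X)}{\#(A)}$ for $0\le i\le d$ (the sum includes $A=\emptyset$), with the convention that $\sigma_i(X)=0$ when $i<0$ or $i>\dim(X)$. The mu-vector $(\mu_0,\dots,\mu_d)$ of a $d$-dimensional simplicial complex $X$ is $$\mu_0(X)=\sum_{x\in V(X)}\frac{1}{1+f_0(\mathrm{lk}(x,X))},\qquad \mu_i(X)=\sum_{x\in V(X)}\frac{\delta_{i1}+\sigma_{i-1}(\mathrm{lk}(x,X))}{1+f_0(\mathrm{lk}(x,X))}\quad(1\le i\le d),$$ where $\delta_{ij}$ is the Kronecker symbol ($1$ if $i=j$, $0$ otherwise).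
   Formalization: The convention σ_i(X)=0 for i>dim(X) is not applied to σ_0({∅}), which is taken to be −1 as the defining sum gives; with the value 0, equality in (a) for j=d fails for the disjoint union of an edge and a vertex. *)

theory Defs
  imports Complex_Main "HOL-Library.Poly_Mapping"
begin

section \<open>Finite abstract simplicial complexes\<close>

definition simplicial_complex :: "'a set set \<Rightarrow> bool" where
  "simplicial_complex X \<longleftrightarrow>
     finite X \<and> {} \<in> X \<and> (\<forall>\<alpha>\<in>X. finite \<alpha> \<and> (\<forall>\<beta>. \<beta> \<subseteq> \<alpha> \<longrightarrow> \<beta> \<in> X))"

definition vertices :: "'a set set \<Rightarrow> 'a set" where
  "vertices X = \<Union>X"

definition f0 :: "'a set set \<Rightarrow> nat" where
  "f0 X = card (vertices X)"

definition dimension :: "'a set set \<Rightarrow> int" where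
  "dimension X = int (Max (card ` X)) - 1"

definition induced :: "'a set set \<Rightarrow> 'a set \<Rightarrow> 'a set set" where
  "induced X A = {\<alpha> \<in> X. \<alpha> \<subseteq> A}"

definition lk :: "'a \<Rightarrow> 'a set set \<Rightarrow> 'a set set" where
  "lk x X = {\<alpha>. x \<notin> \<alpha> \<and> insert x \<alpha> \<in> X}"


section \<open>Unreduced simplicial homology over a field\<close>

text \<open>
  To orient simplices, one arbitrary total order is fixed on the whole type of potential
  vertices (it exists by the well-ordering theorem). All complexes on that type share it, so
  the chain groups of a subcomplex are literally contained in those of the whole complex.
  As usual, homology does not depend on this choice up to isomorphism.
\<close>

definition vertex_order :: "'a rel" where
  "vertex_order = (SOME r. well_order_on UNIV r)"

lemma well_order_on_vertex_order: "well_order_on UNIV vertex_order"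
  unfolding vertex_order_def by (rule someI_ex) (rule well_order_on)

lemma linear_order_on_vertex_order: "linear_order_on UNIV vertex_order"
  using well_order_on_vertex_order by (auto simp: well_order_on_def)

definition cscale :: "'f::field \<Rightarrow> ('a set \<Rightarrow>\<^sub>0 'f) \<Rightarrow> ('a set \<Rightarrow>\<^sub>0 'f)" where
  "cscale a c = Poly_Mapping.map ((*) a) c"

text \<open>
  A chain is a formal linear combination of nonempty faces, a face standing for the simplex
  oriented by the vertex order. The condition \<open>\<sigma> \<noteq> {v}\<close> drops the empty face, so that the
  boundary of a vertex is zero: homology is unreduced, and it vanishes in negative degrees.
\<close>

definition simplex_boundary :: "'a set \<Rightarrow> ('a set \<Rightarrow>\<^sub>0 'f::field)" where
  "simplex_boundary \<sigma> =
     (\<Sum>v | v \<in> \<sigma> \<and> \<sigma> \<noteq> {v}.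
        Poly_Mapping.single (\<sigma> - {v}) ((-1) ^ card {w \<in> \<sigma>. w \<noteq> v \<and> (w, v) \<in> vertex_order}))"

definition boundary :: "('a set \<Rightarrow>\<^sub>0 'f::field) \<Rightarrow> ('a set \<Rightarrow>\<^sub>0 'f)" where
  "boundary c =
     (\<Sum>\<sigma>\<in>Poly_Mapping.keys c. cscale (Poly_Mapping.lookup c \<sigma>) (simplex_boundary \<sigma>))"

definition chains :: "'a set set \<Rightarrow> int \<Rightarrow> ('a set \<Rightarrow>\<^sub>0 'f::field) set" where
  "chains X i = {c. \<forall>\<sigma>\<in>Poly_Mapping.keys c. \<sigma> \<in> X \<and> \<sigma> \<noteq> {} \<and> int (card \<sigma>) = i + 1}"

definition cycles :: "'a set set \<Rightarrow> int \<Rightarrow> ('a set \<Rightarrow>\<^sub>0 'f::field) set" where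
  "cycles X i = {c \<in> chains X i. boundary c = 0}"

definition boundaries :: "'a set set \<Rightarrow> int \<Rightarrow> ('a set \<Rightarrow>\<^sub>0 'f::field) set" where
  "boundaries X i = boundary ` chains X (i + 1)"

definition homologous :: "'a set set \<Rightarrow> int \<Rightarrow> ('a set \<Rightarrow>\<^sub>0 'f::field) rel" where
  "homologous X i = {(c, c'). c \<in> cycles X i \<and> c' \<in> cycles X i \<and> c - c' \<in> boundaries X i}"

definition homology :: "'a set set \<Rightarrow> int \<Rightarrow> ('a set \<Rightarrow>\<^sub>0 'f::field) set set" where
  "homology X i = cycles X i // homologous X i"

text \<open>
  The morphism induced by the inclusion of a subcomplex \<open>Y\<close> of \<open>X\<close>: the image of the class in
  \<open>Y\<close> of a cycle \<open>c\<close> under the relation \<open>homologous X i\<close> is the class of \<open>c\<close> in \<open>X\<close>.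
\<close>

definition inclusion_hom ::
    "'a set set \<Rightarrow> int \<Rightarrow> ('a set \<Rightarrow>\<^sub>0 'f::field) set \<Rightarrow> ('a set \<Rightarrow>\<^sub>0 'f) set" where
  "inclusion_hom X i C = homologous X i `` C"

text \<open>
  Linear independence in the quotient space \<open>homology X i\<close>: a linear combination of classes is
  computed on representatives \<open>r\<close>, and it is zero iff the resulting cycle is a boundary. The
  choice of the representatives does not matter.
\<close>

definition independent_classes :: "'a set set \<Rightarrow> int \<Rightarrow> ('a set \<Rightarrow>\<^sub>0 'f::field) set set \<Rightarrow> bool" where
  "independent_classes X i S \<longleftrightarrow>
     finite S \<and> S \<subseteq> homology X i \<and>
     (\<forall>(a :: ('a set \<Rightarrow>\<^sub>0 'f) set \<Rightarrow> 'f) r.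
        (\<forall>C\<in>S. r C \<in> C) \<and> (\<Sum>C\<in>S. cscale (a C) (r C)) \<in> boundaries X i \<longrightarrow>
        (\<forall>C\<in>S. a C = 0))"

definition betti :: "'f::field itself \<Rightarrow> 'a set set \<Rightarrow> int \<Rightarrow> nat" where
  "betti F X i = Max (card ` {S :: ('a set \<Rightarrow>\<^sub>0 'f) set set. independent_classes X i S})"

definition reduced_betti :: "'f::field itself \<Rightarrow> 'a set set \<Rightarrow> int \<Rightarrow> int" where
  "reduced_betti F X i = (if i = 0 then int (betti F X 0) - 1 else int (betti F X i))"


section \<open>Sigma- and mu-vectors\<close>

text \<open>
  The sigma-vector is zero in negative degrees and above the dimension, with one exception: the
  complex \<open>{{}}\<close>, of dimension \<open>-1\<close>, has value \<open>-1\<close> in degree \<open>0\<close>, as given by the defining sum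
  (whose only term is its reduced Betti number \<open>-1\<close>), whence \<open>max 0\<close>. It occurs as the link of an
  isolated vertex; with value \<open>0\<close> instead, the Morse relations would fail already for the disjoint
  union of an edge and a vertex.
\<close>

definition sigma :: "'f::field itself \<Rightarrow> 'a set set \<Rightarrow> int \<Rightarrow> real" where
  "sigma F X i =
     (if i < 0 \<or> i > max 0 (dimension X) then 0
      else \<Sum>A\<in>Pow (vertices X).
             real_of_int (reduced_betti F (induced X A) i) / real (f0 X choose card A))"

definition mu :: "'f::field itself \<Rightarrow> 'a set set \<Rightarrow> nat \<Rightarrow> real" where
  "mu F X i =
     (if i = 0 then \<Sum>x\<in>vertices X. 1 / (1 + real (f0 (lk x X)))
      else \<Sum>x\<in>vertices X.
             ((if i = 1 then 1 else 0) + sigma F (lk x X) (int i - 1)) / (1 + real (f0 (lk x X))))"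

end

theory Submission
  imports Defs
begin

text \<open>
  Order the vertices of \<open>X\<close> and build \<open>X\<close> by adding them one at a time. Adding \<open>x\<close> to the set \<open>A\<close> of
  its predecessors glues a cone over \<open>L = lk(x, X)[A]\<close> to \<open>X[A]\<close>, so the homology of the pair
  \<open>(X[A \<union> {x}], X[A])\<close> in degree \<open>i\<close> is the reduced homology of \<open>L\<close> in degree \<open>i - 1\<close>. Call its dimension
  \<open>rel_betti\<close>. The coefficients in the definition of the mu-vector are exactly the probabilities that,
  in a random order, the predecessors of \<open>x\<close> in its link form a given set. Hence \<open>\<mu>\<^sub>i\<close> is the expected
  number of relative classes of degree \<open>i\<close> created in the course of the construction
  (\<open>mu_eq_weighted_sum\<close>), and the theorem is an averaged form of the Morse inequalities.

  At each step, the alternating sum up to \<open>j\<close> of the relative Betti numbers exceeds the increment of the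
  alternating sum of Betti numbers of \<open>X[A]\<close> by the dimension of the kernel of
  \<open>H\<^sub>j(X[A]) \<rightarrow> H\<^sub>j(X[A \<union> {x}])\<close> (\<open>excess_eq\<close>). Instead of the long exact sequence, the proof counts
  ranks. The alternating sums of Betti numbers equal alternating face numbers minus one rank of a
  boundary map; the face numbers on both sides agree; and the ranks are compared by rank-nullity for
  the projection of the boundaries of \<open>X[A \<union> {x}]\<close> to the simplices that contain \<open>x\<close>
  (\<open>rk_remove_vertex\<close>). Its image is identified with the boundaries of the link by the chain map that
  sends a simplex of the link to its cone.

  The increments telescope (\<open>weight_sum_increments\<close>), so the two sides of (a) differ by a sum of kernel
  dimensions with positive weights (\<open>alt_mu_minus_alt_betti\<close>). It is nonnegative, and it vanishes iff
  all maps that add one vertex are injective on \<open>H\<^sub>j\<close>, iff all the maps into \<open>H\<^sub>j(X)\<close> are. In the top degree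
  they always are, since the only boundary is zero. Adding the relations (a) for \<open>j\<close> and \<open>j - 1\<close> gives
  (c), with equality iff both are equalities; this is (d), as \<open>H\<^sub>-\<^sub>1 = 0\<close> settles the case \<open>j = 0\<close>.
\<close>

section \<open>Finite-dimensional linear algebra\<close>

text \<open>
  A family that is linearly independent modulo \<open>B\<close> can be added, one vector at a time, to a basis
  of \<open>B\<close> without destroying independence. It is a family rather than a set because a homology class
  is only known through a representative.
\<close>

lemma (in vector_space) card_independent_mod_le:
  assumes B: "subspace B" "B \<subseteq> Z" and Z: "subspace Z" "Z \<subseteq> span T" "finite T"
    and S: "finite S" "\<And>s. s \<in> S \<Longrightarrow> v s \<in> Z"
    and indep: "\<And>a. (\<Sum>s\<in>S. scale (a s) (v s)) \<in> B \<Longrightarrow> (\<forall>s\<in>S. a s = 0)"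
  shows "card S + dim B \<le> dim Z"
proof -
  have "\<exists>b. independent b \<and> finite b \<and> b \<subseteq> Z \<and> card b = card S + dim B \<and>
          span b \<subseteq> {y + (\<Sum>s\<in>S. scale (a s) (v s)) | y a. y \<in> B}"
    using S indep
  proof (induction S rule: finite_induct)
    case empty
    obtain b where b: "b \<subseteq> B" "independent b" "B \<subseteq> span b" "card b = dim B"
      using basis_exists by blast
    have "finite b"
      using independent_span_bound[OF Z(3) b(2)] b(1) B(2) Z(2) by blast
    moreover have "span b \<subseteq> B"
      using b(1) B(1) by (simp add: span_minimal)
    ultimately show ?case
      using b B(2) by (intro exI[of _ b]) auto
  next
    case (insert x S)
    have "\<exists>b. independent b \<and> finite b \<and> b \<subseteq> Z \<and> card b = card S + dim B \<and>
          span b \<subseteq> {y + (\<Sum>s\<in>S. scale (a s) (v s)) | y a. y \<in> B}"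
    proof (rule insert.IH)
      fix a assume a: "(\<Sum>s\<in>S. scale (a s) (v s)) \<in> B"
      have "(\<Sum>s\<in>insert x S. scale ((a(x := 0)) s) (v s)) = (\<Sum>s\<in>S. scale (a s) (v s))"
        using insert.hyps by (auto intro!: sum.cong)
      with a have "\<forall>s\<in>insert x S. (a(x := 0)) s = 0"
        using insert.prems(2) by presburger
      then show "\<forall>s\<in>S. a s = 0"
        using insert.hyps(2) by (metis fun_upd_other insertCI)
    qed (use insert in auto)
    then obtain b where b: "independent b" "finite b" "b \<subseteq> Z" "card b = card S + dim B"
        "span b \<subseteq> {y + (\<Sum>s\<in>S. scale (a s) (v s)) | y a. y \<in> B}"
      by blast
    have ins: "(\<Sum>s\<in>insert x S. scale ((a(x := k)) s) (v s)) =
        scale k (v x) + (\<Sum>s\<in>S. scale (a s) (v s))" for k a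
      using insert.hyps by (auto intro!: sum.cong)
    have vx: "v x \<notin> span b"
    proof
      assume "v x \<in> span b"
      then obtain y a where ya: "y \<in> B" "v x = y + (\<Sum>s\<in>S. scale (a s) (v s))"
        using b(5) by blast
      have "(\<Sum>s\<in>insert x S. scale (((\<lambda>s. - a s)(x := 1)) s) (v s)) = y"
        unfolding ins using ya(2) by (simp add: sum_negf)
      \<comment> \<open>a combination with coefficient \<open>1\<close> at \<open>x\<close>, which cannot lie in \<open>B\<close>\<close>
      then have "\<forall>s\<in>insert x S. ((\<lambda>s. - a s)(x := 1)) s = 0"
        using insert.prems(2) ya(1) by presburger
      then show False
        by simp
    qed
    have "span (insert (v x) b) \<subseteq> {y + (\<Sum>s\<in>insert x S. scale (a s) (v s)) | y a. y \<in> B}"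
    proof
      fix z assume "z \<in> span (insert (v x) b)"
      then obtain k where "z - scale k (v x) \<in> span b"
        by (auto simp: span_insert)
      then obtain y a where ya: "y \<in> B" "z - scale k (v x) = y + (\<Sum>s\<in>S. scale (a s) (v s))"
        using b(5) by blast
      then have "z = y + (\<Sum>s\<in>insert x S. scale ((a(x := k)) s) (v s))"
        unfolding ins by (simp add: algebra_simps)
      with ya(1) show "z \<in> {y + (\<Sum>s\<in>insert x S. scale (a s) (v s)) | y a. y \<in> B}"
        by blast
    qed
    moreover have "v x \<notin> b"
      using vx span_base by blast
    ultimately show ?case
      using b vx insert.hyps insert.prems(1)
      by (intro exI[of _ "insert (v x) b"]) (auto simp: independent_insert)
  qed
  then obtain b where b: "independent b" "b \<subseteq> Z" "card b = card S + dim B"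
    by blast
  obtain c where c: "c \<subseteq> Z" "independent c" "Z \<subseteq> span c" "card c = dim Z"
    using basis_exists by blast
  have "finite c"
    using independent_span_bound[OF Z(3) c(2)] c(1) Z(2) by blast
  then show ?thesis
    using independent_span_bound[OF _ b(1), of c] b c(3,4) by fastforce
qed

text \<open>
  The vectors that extend a basis of \<open>B\<close> to one of \<open>Z\<close>; they represent a basis of \<open>Z / B\<close>.
\<close>

lemma (in vector_space) ex_independent_mod:
  assumes B: "subspace B" "B \<subseteq> Z" and Z: "subspace Z" "Z \<subseteq> span T" "finite T"
  obtains S where "finite S" "S \<subseteq> Z" "card S + dim B = dim Z" "independent S"
    "\<And>a. (\<Sum>s\<in>S. scale (a s) s) \<in> B \<Longrightarrow> (\<forall>s\<in>S. a s = 0)"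
    "\<And>z. z \<in> Z \<Longrightarrow> \<exists>y\<in>B. z - y \<in> span S"
proof -
  obtain b where b: "b \<subseteq> B" "independent b" "B \<subseteq> span b" "card b = dim B"
    using basis_exists by blast
  obtain c where c: "b \<subseteq> c" "c \<subseteq> Z" "independent c" "Z \<subseteq> span c"
    using maximal_independent_subset_extend[of b Z] b(1,2) B(2) by blast
  have fin: "finite c"
    using independent_span_bound[OF Z(3) c(3)] c(2) Z(2) by blast
  then have finb: "finite b"
    using c(1) finite_subset by blast
  have "card (c - b) + dim B = dim Z"
    using card_Diff_subset[OF finb c(1)] card_mono[OF fin c(1)] b(4) basis_card_eq_dim[OF c(2,4,3)]
    by simp
  moreover have "\<forall>s\<in>c - b. a s = 0" if asm: "(\<Sum>s\<in>c - b. scale (a s) s) \<in> B" for a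
  proof -
    obtain u where u: "(\<Sum>s\<in>c - b. scale (a s) s) = (\<Sum>s\<in>b. scale (u s) s)"
      using subsetD[OF b(3) asm] unfolding span_finite[OF finb] by blast
    define h where "h s = (if s \<in> b then - u s else a s)" for s
    have "(\<Sum>s\<in>c. scale (h s) s) = (\<Sum>s\<in>c - b. scale (h s) s) + (\<Sum>s\<in>b. scale (h s) s)"
      using sum.subset_diff[OF c(1) fin] by blast
    also have "\<dots> = (\<Sum>s\<in>c - b. scale (a s) s) + (\<Sum>s\<in>b. - scale (u s) s)"
      by (intro arg_cong2[where f = "(+)"] sum.cong) (auto simp: h_def)
    also have "\<dots> = 0"
      using u by (simp add: sum_negf)
    finally have "\<forall>s\<in>c. h s = 0"
      using c(3) fin unfolding independent_explicit_finite_subsets by blast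
    then show ?thesis
      by (auto simp: h_def)
  qed
  moreover have "\<exists>y\<in>B. z - y \<in> span (c - b)" if "z \<in> Z" for z
  proof -
    have "z \<in> span (b \<union> (c - b))"
      using c(1,4) that by (auto simp: Un_absorb1)
    then obtain y w where "z = y + w" "y \<in> span b" "w \<in> span (c - b)"
      unfolding span_Un by blast
    moreover have "span b \<subseteq> B"
      using b(1) B(1) by (simp add: span_minimal)
    ultimately show ?thesis
      by (intro bexI[of _ y]) auto
  qed
  ultimately show ?thesis
    using fin c(2) independent_mono[OF c(3), of "c - b"] by (intro that[of "c - b"]) auto
qed

text \<open>
  A complement of the kernel, as given by \<open>ex_independent_mod\<close>, is mapped isomorphically onto the
  image. Chains on an infinite type of vertices form a space of infinite dimension, hence the bound
  on \<open>Z\<close> alone.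
\<close>

lemma (in vector_space) rank_nullity:
  assumes f: "Vector_Spaces.linear scale scale f"
    and Z: "subspace Z" "Z \<subseteq> span T" "finite T"
  shows "dim Z = dim (f ` Z) + dim {z \<in> Z. f z = 0}"
proof -
  interpret f: Vector_Spaces.linear scale scale f by fact
  let ?K = "{z \<in> Z. f z = 0}"
  have K: "subspace ?K"
    using subspace_inter[OF Z(1) f.subspace_kernel] by (simp add: Int_def)
  obtain S where S: "finite S" "S \<subseteq> Z" "card S + dim ?K = dim Z" "independent S"
    "\<And>a. (\<Sum>s\<in>S. scale (a s) s) \<in> ?K \<Longrightarrow> (\<forall>s\<in>S. a s = 0)"
    "\<And>z. z \<in> Z \<Longrightarrow> \<exists>y\<in>?K. z - y \<in> span S"
    using ex_independent_mod[OF K _ Z] by blast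
  have SZ: "span S \<subseteq> Z"
    using S(2) Z(1) by (simp add: span_minimal)
  have "inj_on f (span S)"
    unfolding f.inj_on_iff_eq_0[OF subspace_span]
  proof (intro ballI impI)
    fix x assume x: "x \<in> span S" "f x = 0"
    then obtain a where a: "x = (\<Sum>s\<in>S. scale (a s) s)"
      using span_finite[OF S(1)] by auto
    have "\<forall>s\<in>S. a s = 0"
      using S(5) x SZ a by blast
    then show "x = 0"
      using a by simp
  qed
  then have "independent (f ` S)" "card (f ` S) = card S"
    using f.independent_injective_image[OF S(4)] card_image[of f S] inj_on_subset[OF _ span_superset]
    by blast+
  moreover have "f ` S \<subseteq> f ` Z"
    using S(2) by blast
  moreover have "f ` Z \<subseteq> span (f ` S)"
  proof
    fix w assume "w \<in> f ` Z"
    then obtain z where z: "z \<in> Z" "w = f z"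
      by blast
    then obtain y where "y \<in> ?K" "z - y \<in> span S"
      using S(6) by blast
    then show "w \<in> span (f ` S)"
      using z f.span_image[of S] f.diff[of z y] by (auto intro!: image_eqI[of _ _ "z - y"])
  qed
  ultimately have "dim (f ` Z) = card S"
    by (metis basis_card_eq_dim)
  then show ?thesis
    using S(3) by simp
qed

lemma (in vector_space) dim_zero_subspace: "dim {0} = 0"
  using dim_eq_card_independent[OF independent_empty] dim_span[of "{}"] by simp

lemma (in vector_space) dim_injective_image:
  assumes f: "Vector_Spaces.linear scale scale f"
    and Z: "subspace Z" "Z \<subseteq> span T" "finite T" and inj: "inj_on f Z"
  shows "dim (f ` Z) = dim Z"
proof -
  interpret f: Vector_Spaces.linear scale scale f by fact
  have "{z \<in> Z. f z = 0} = {0}"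
    using inj f.zero subspace_0[OF Z(1)] by (auto simp: inj_on_def)
  then show ?thesis
    using rank_nullity[OF f Z] dim_zero_subspace by simp
qed

lemma (in vector_space) subspace_dim_mono:
  assumes "subspace B" "B \<subseteq> Z" "subspace Z" "Z \<subseteq> span T" "finite T"
  shows "dim B \<le> dim Z" "dim B = dim Z \<longleftrightarrow> Z = B"
proof -
  obtain S where S: "finite S" "card S + dim B = dim Z"
    "\<And>z. z \<in> Z \<Longrightarrow> \<exists>y\<in>B. z - y \<in> span S"
    using ex_independent_mod[OF assms] by metis
  show "dim B \<le> dim Z"
    using S(2) by simp
  show "dim B = dim Z \<longleftrightarrow> Z = B"
  proof
    assume "dim B = dim Z"
    then have "S = {}"
      using S(1,2) by simp
    then show "Z = B"
      using S(3) assms(2) by auto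
  qed auto
qed

section \<open>Averaging over the orders of a finite set\<close>

text \<open>
  For \<open>x\<close> in a set with \<open>m + 1\<close> elements and a set \<open>A\<close> of \<open>a\<close> other elements, this is the probability
  that the elements before \<open>x\<close> in a uniformly random order are exactly those of \<open>A\<close>. With it the
  averages over orders become sums over sets, and no order needs to be mentioned.
\<close>

definition weight :: "nat \<Rightarrow> nat \<Rightarrow> real" where
  "weight m a = fact a * fact (m - a) / fact (Suc m)"

lemma weight_pos: "weight m a > 0"
  by (simp add: weight_def)

lemma weight_binomial:
  assumes "a \<le> m"
  shows "weight m a = 1 / ((1 + real m) * real (m choose a))"
  using assms by (simp add: weight_def binomial_fact field_simps)

text \<open>
  One further element comes either after \<open>x\<close> or before it.
\<close>

lemma weight_split:
  assumes "a \<le> m"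
  shows "weight m a = weight (Suc m) a + weight (Suc m) (Suc a)"
proof -
  have "weight (Suc m) a + weight (Suc m) (Suc a) =
     (fact a * fact (Suc m - a) + fact (Suc a) * fact (m - a)) / fact (Suc (Suc m))"
    by (simp add: weight_def add_divide_distrib)
  also have "fact a * fact (Suc m - a) + fact (Suc a) * fact (m - a)
     = (real (Suc (Suc m))) * (fact a * fact (m - a))"
    using assms by (simp add: Suc_diff_le algebra_simps of_nat_diff)
  also have "\<dots> / fact (Suc (Suc m)) = weight m a"
    unfolding weight_def fact_Suc[of "Suc m"]
    by (simp del: fact_Suc of_nat_Suc)
  finally show ?thesis ..
qed

lemma sum_Pow_insert:
  fixes f :: "'a set \<Rightarrow> real"
  assumes "finite S" "u \<notin> S"
  shows "(\<Sum>A\<in>Pow (insert u S). f A) = (\<Sum>A\<in>Pow S. f A + f (insert u A))"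
proof -
  have "inj_on (insert u) (Pow S)"
    using assms(2) by (auto simp: inj_on_def)
  moreover have "Pow S \<inter> insert u ` Pow S = {}"
    using assms(2) by auto
  ultimately show ?thesis
    using assms(1)
    by (simp add: Pow_insert sum.union_disjoint sum.reindex sum.distrib)
qed

text \<open>
  A random order of a set restricts to a random order of any subset: if \<open>A\<close> is the set of elements
  before \<open>x\<close>, then \<open>A \<inter> L\<close> has the distribution that belongs to \<open>L\<close> alone.
\<close>

lemma weight_sum_Int:
  fixes \<phi> :: "'a set \<Rightarrow> real"
  assumes "finite U" "finite L" "L \<inter> U = {}"
  shows "(\<Sum>A\<in>Pow (L \<union> U). weight (card (L \<union> U)) (card A) * \<phi> (A \<inter> L))
       = (\<Sum>B\<in>Pow L. weight (card L) (card B) * \<phi> B)"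
  using assms(1,3)
proof (induction U rule: finite_induct)
  case empty
  show ?case
    by (auto intro!: sum.cong simp: Int_absorb2)
next
  case (insert u U)
  have u: "u \<notin> L \<union> U" and fin: "finite (L \<union> U)"
    using insert assms(2) by auto
  have "(\<Sum>A\<in>Pow (L \<union> insert u U). weight (card (L \<union> insert u U)) (card A) * \<phi> (A \<inter> L))
      = (\<Sum>A\<in>Pow (L \<union> U). weight (Suc (card (L \<union> U))) (card A) * \<phi> (A \<inter> L)
           + weight (Suc (card (L \<union> U))) (card (insert u A)) * \<phi> (insert u A \<inter> L))"
    using sum_Pow_insert[OF fin u] u fin by simp
  also have "\<dots> = (\<Sum>A\<in>Pow (L \<union> U). weight (card (L \<union> U)) (card A) * \<phi> (A \<inter> L))"
  proof (rule sum.cong[OF refl])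
    fix A assume A: "A \<in> Pow (L \<union> U)"
    then have "u \<notin> A"
      using u by blast
    with A have "card (insert u A) = Suc (card A)" "insert u A \<inter> L = A \<inter> L"
      "card A \<le> card (L \<union> U)"
      using u fin finite_subset[of A "L \<union> U"] card_mono[OF fin, of A] by auto
    then show "weight (Suc (card (L \<union> U))) (card A) * \<phi> (A \<inter> L)
           + weight (Suc (card (L \<union> U))) (card (insert u A)) * \<phi> (insert u A \<inter> L)
           = weight (card (L \<union> U)) (card A) * \<phi> (A \<inter> L)"
      by (simp add: weight_split[of "card A" "card (L \<union> U)"] algebra_simps)
  qed
  also have "\<dots> = (\<Sum>B\<in>Pow L. weight (card L) (card B) * \<phi> B)"
    using insert by auto
  finally show ?case .
qed

text \<open>
  Along every order the increments of \<open>g\<close> telescope to \<open>g V - g {}\<close>; this is the average of that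
  identity. In the proof, \<open>c b\<close> is the probability that a given set of \<open>b\<close> elements is an initial
  segment: every set other than \<open>V\<close> and \<open>{}\<close> enters once with each sign, and cancels.
\<close>

lemma weight_sum_increments:
  fixes g :: "'a set \<Rightarrow> real"
  assumes V: "finite V"
  shows "(\<Sum>x\<in>V. \<Sum>A\<in>Pow (V - {x}). weight (card V - 1) (card A) * (g (insert x A) - g A))
       = g V - g {}"
proof -
  let ?n = "card V"
  define c :: "nat \<Rightarrow> real" where "c b = fact b * fact (?n - b) / fact ?n" for b
  have "(\<Sum>x\<in>V. \<Sum>A\<in>Pow (V - {x}). weight (?n - 1) (card A) * g (insert x A))
      = (\<Sum>x\<in>V. \<Sum>B\<in>{B \<in> Pow V. x \<in> B}. weight (?n - 1) (card B - 1) * g B)"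
  proof (rule sum.cong[OF refl])
    fix x assume x: "x \<in> V"
    have "card (insert x A) = Suc (card A)" if "A \<subseteq> V - {x}" for A
      using that finite_subset[of A V] V by (subst card_insert_disjoint) auto
    then show "(\<Sum>A\<in>Pow (V - {x}). weight (?n - 1) (card A) * g (insert x A))
        = (\<Sum>B\<in>{B \<in> Pow V. x \<in> B}. weight (?n - 1) (card B - 1) * g B)"
      using x
      by (intro sum.reindex_bij_witness[of _ "\<lambda>B. B - {x}" "insert x"])
        (auto simp: insert_absorb)
  qed
  also have "\<dots> = (\<Sum>B\<in>Pow V. \<Sum>x\<in>{x \<in> V. x \<in> B}. weight (?n - 1) (card B - 1) * g B)"
    using V by (intro sum.swap_restrict) auto
  also have "\<dots> = (\<Sum>B\<in>Pow V. if B = {} then 0 else c (card B) * g B)"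
  proof (rule sum.cong[OF refl])
    fix B assume B: "B \<in> Pow V"
    then have [simp]: "{x \<in> V. x \<in> B} = B"
      by auto
    show "(\<Sum>x\<in>{x \<in> V. x \<in> B}. weight (?n - 1) (card B - 1) * g B)
        = (if B = {} then 0 else c (card B) * g B)"
    proof (cases "B = {}")
      case False
      have fB: "finite B" using B V finite_subset by auto
      obtain k where k: "card B = Suc k"
        using False fB by (metis card_eq_0_iff not0_implies_Suc)
      moreover obtain m where m: "?n = Suc m"
        using B V k card_mono[of V B] by (metis PowD Suc_le_D)
      ultimately have "real (card B) * weight (?n - 1) (card B - 1) = c (card B)"
        by (simp add: weight_def c_def)
      then show ?thesis
        using False by (simp flip: mult.assoc)
    qed simp
  qed
  also have "\<dots> = (\<Sum>B\<in>Pow V. c (card B) * g B) - c 0 * g {}"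
    using V by (subst (1 2) sum.remove[of _ "{}"]) auto
  finally have 1: "(\<Sum>x\<in>V. \<Sum>A\<in>Pow (V - {x}). weight (?n - 1) (card A) * g (insert x A))
     = (\<Sum>B\<in>Pow V. c (card B) * g B) - c 0 * g {}" .
  have "(\<Sum>x\<in>V. \<Sum>A\<in>Pow (V - {x}). weight (?n - 1) (card A) * g A)
      = (\<Sum>x\<in>V. \<Sum>A\<in>{A \<in> Pow V. x \<notin> A}. weight (?n - 1) (card A) * g A)"
    by (intro sum.cong refl) auto
  also have "\<dots> = (\<Sum>A\<in>Pow V. \<Sum>x\<in>{x \<in> V. x \<notin> A}. weight (?n - 1) (card A) * g A)"
    using V by (intro sum.swap_restrict) auto
  also have "\<dots> = (\<Sum>A\<in>Pow V. if A = V then 0 else c (card A) * g A)"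
  proof (rule sum.cong[OF refl])
    fix A assume A: "A \<in> Pow V"
    have e: "{x \<in> V. x \<notin> A} = V - A"
      by auto
    show "(\<Sum>x\<in>{x \<in> V. x \<notin> A}. weight (?n - 1) (card A) * g A)
        = (if A = V then 0 else c (card A) * g A)"
    proof (cases "A = V")
      case False
      have fA: "finite A" using A V finite_subset by auto
      have "card A < ?n"
        using A V False by (intro psubset_card_mono) auto
      then obtain k where k: "?n = Suc (card A + k)"
        using less_iff_Suc_add by blast
      then have "card (V - A) = Suc k"
        using A fA by (simp add: card_Diff_subset)
      then have "real (card (V - A)) * weight (?n - 1) (card A) = c (card A)"
        using k by (simp add: weight_def c_def Suc_diff_le)
      then show ?thesis
        using False unfolding e by (simp flip: mult.assoc)
    qed (simp add: e)
  qed
  also have "\<dots> = (\<Sum>A\<in>Pow V. c (card A) * g A) - c ?n * g V"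
    using V by (subst (1 2) sum.remove[of _ V]) auto
  finally have 2: "(\<Sum>x\<in>V. \<Sum>A\<in>Pow (V - {x}). weight (?n - 1) (card A) * g A)
     = (\<Sum>A\<in>Pow V. c (card A) * g A) - c ?n * g V" .
  have "c 0 = 1" "c ?n = 1"
    by (simp_all add: c_def)
  with 1 2 show ?thesis
    by (simp add: right_diff_distrib sum_subtractf)
qed

section \<open>The vector space of chains\<close>

lemma lookup_cscale: "Poly_Mapping.lookup (cscale a c) s = a * Poly_Mapping.lookup c s"
  by (simp add: cscale_def Poly_Mapping.map.rep_eq when_def)

interpretation chain: vector_space "cscale :: 'f::field \<Rightarrow> ('a set \<Rightarrow>\<^sub>0 'f) \<Rightarrow> _"
  by unfold_locales (auto intro!: poly_mapping_eqI simp: lookup_cscale lookup_add algebra_simps)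

interpretation chain_pair: vector_space_pair
  "cscale :: 'f::field \<Rightarrow> ('a set \<Rightarrow>\<^sub>0 'f) \<Rightarrow> _" "cscale :: 'f::field \<Rightarrow> ('b set \<Rightarrow>\<^sub>0 'f) \<Rightarrow> _"
  by unfold_locales

abbreviation chain_linear :: "(('a set \<Rightarrow>\<^sub>0 'f::field) \<Rightarrow> ('a set \<Rightarrow>\<^sub>0 'f)) \<Rightarrow> bool" where
  "chain_linear \<equiv> Vector_Spaces.linear cscale cscale"

text \<open>
  Working with the chains supported on an arbitrary set of simplices, rather than on a complex, allows
  the chains that contain a vertex, or avoid it, to be treated in the same way.
\<close>

definition supported :: "'a set set \<Rightarrow> ('a set \<Rightarrow>\<^sub>0 'f::field) set" where
  "supported S = {c. Poly_Mapping.keys c \<subseteq> S}"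

abbreviation face :: "'a set \<Rightarrow> ('a set \<Rightarrow>\<^sub>0 'f::field)" where
  "face \<sigma> \<equiv> Poly_Mapping.single \<sigma> 1"

lemma cscale_single: "cscale a (Poly_Mapping.single \<sigma> b) = Poly_Mapping.single \<sigma> (a * b)"
  by (auto intro!: poly_mapping_eqI simp: lookup_cscale lookup_single when_def)

lemma keys_cscale: "Poly_Mapping.keys (cscale a c) \<subseteq> Poly_Mapping.keys c"
  by (auto simp: in_keys_iff lookup_cscale)

lemma subspace_supported: "chain.subspace (supported S)"
  unfolding chain.subspace_def supported_def
  by (auto dest: subsetD[OF keys_cscale] subsetD[OF Poly_Mapping.keys_add])

lemma sum_faces:
  assumes "finite T" "Poly_Mapping.keys c \<subseteq> T"
  shows "c = (\<Sum>\<sigma>\<in>T. cscale (Poly_Mapping.lookup c \<sigma>) (face \<sigma>))"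
proof (rule poly_mapping_eqI)
  fix \<tau>
  have "Poly_Mapping.lookup (\<Sum>\<sigma>\<in>T. cscale (Poly_Mapping.lookup c \<sigma>) (face \<sigma>)) \<tau>
      = (\<Sum>\<sigma>\<in>T. if \<sigma> = \<tau> then Poly_Mapping.lookup c \<sigma> else 0)"
    by (auto simp: lookup_sum cscale_single lookup_single when_def intro!: sum.cong)
  also have "\<dots> = Poly_Mapping.lookup c \<tau>"
    using assms by (auto simp: in_keys_iff)
  finally show "Poly_Mapping.lookup c \<tau> =
      Poly_Mapping.lookup (\<Sum>\<sigma>\<in>T. cscale (Poly_Mapping.lookup c \<sigma>) (face \<sigma>)) \<tau>" ..
qed

lemma supported_eq_span: "supported S = chain.span (face ` S)"
proof
  show "supported S \<subseteq> chain.span (face ` S)"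
  proof
    fix c assume c: "c \<in> supported S"
    have "(\<Sum>\<sigma>\<in>Poly_Mapping.keys c. cscale (Poly_Mapping.lookup c \<sigma>) (face \<sigma>))
        \<in> chain.span (face ` S)"
      using c by (intro chain.span_sum chain.span_scale chain.span_base) (auto simp: supported_def)
    then show "c \<in> chain.span (face ` S)"
      using sum_faces[of "Poly_Mapping.keys c" c] by simp
  qed
  show "chain.span (face ` S) \<subseteq> supported S"
    by (rule chain.span_minimal[OF _ subspace_supported]) (auto simp: supported_def)
qed

lemma dim_supported:
  assumes "finite S"
  shows "chain.dim (supported S :: ('a set \<Rightarrow>\<^sub>0 'f::field) set) = card S"
proof -
  let ?e = "face :: 'a set \<Rightarrow> ('a set \<Rightarrow>\<^sub>0 'f)"
  have inj: "inj ?e"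
    by (rule injI) (metis lookup_single_eq lookup_single_not_eq zero_neq_one)
  have "chain.independent (?e ` S)"
  proof (rule chain.independent_if_scalars_zero)
    fix h x assume h: "(\<Sum>x\<in>?e ` S. cscale (h x) x) = 0" and "x \<in> ?e ` S"
    then obtain \<tau> where \<tau>: "\<tau> \<in> S" "x = ?e \<tau>"
      by blast
    have "0 = Poly_Mapping.lookup (\<Sum>\<sigma>\<in>S. cscale (h (?e \<sigma>)) (?e \<sigma>)) \<tau>"
      using h inj by (simp add: sum.reindex inj_on_subset)
    also have "\<dots> = (\<Sum>\<sigma>\<in>S. if \<sigma> = \<tau> then h (?e \<tau>) else 0)"
      by (auto simp: lookup_sum cscale_single lookup_single when_def intro!: sum.cong)
    also have "\<dots> = h x"
      using \<tau> assms by simp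
    finally show "h x = 0" ..
  qed (use assms in simp)
  then have "chain.dim (chain.span (?e ` S)) = card (?e ` S)"
    by (rule chain.dim_span_eq_card_independent)
  then show ?thesis
    unfolding supported_eq_span using card_image[of ?e S] inj inj_on_subset by auto
qed

definition lin_ext :: "('a set \<Rightarrow> ('a set \<Rightarrow>\<^sub>0 'f::field)) \<Rightarrow> ('a set \<Rightarrow>\<^sub>0 'f) \<Rightarrow> ('a set \<Rightarrow>\<^sub>0 'f)" where
  "lin_ext g c = (\<Sum>\<sigma>\<in>Poly_Mapping.keys c. cscale (Poly_Mapping.lookup c \<sigma>) (g \<sigma>))"

lemma lin_ext_superset:
  assumes "finite T" "Poly_Mapping.keys c \<subseteq> T"
  shows "lin_ext g c = (\<Sum>\<sigma>\<in>T. cscale (Poly_Mapping.lookup c \<sigma>) (g \<sigma>))"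
  unfolding lin_ext_def using assms
  by (intro sum.mono_neutral_left) (auto simp: in_keys_iff)

lemma linear_lin_ext: "chain_linear (lin_ext g)"
proof -
  have "lin_ext g (c + c') = lin_ext g c + lin_ext g c'" for c c'
  proof -
    let ?T = "Poly_Mapping.keys c \<union> Poly_Mapping.keys c'"
    show ?thesis
      using Poly_Mapping.keys_add[of c c']
      by (simp add: lin_ext_superset[of ?T] lookup_add chain.scale_left_distrib sum.distrib)
  qed
  moreover have "lin_ext g (cscale a c) = cscale a (lin_ext g c)" for a c
    using keys_cscale[of a c]
    by (simp add: lin_ext_superset[of "Poly_Mapping.keys c"] lookup_cscale chain.scale_sum_right)
  ultimately show ?thesis
    by (simp add: Vector_Spaces.linear_iff chain.vector_space_axioms)
qed

lemma lin_ext_single: "lin_ext g (Poly_Mapping.single \<sigma> a) = cscale a (g \<sigma>)"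
  by (cases "a = 0") (simp_all add: lin_ext_def)

lemma linear_eq_on_supported:
  assumes "chain_linear f" "chain_linear g" "\<And>\<sigma>. \<sigma> \<in> S \<Longrightarrow> f (face \<sigma>) = g (face \<sigma>)"
    and "c \<in> supported S"
  shows "f c = g c"
proof (rule chain_pair.linear_eq_on[OF assms(1,2)])
  show "c \<in> chain.span (face ` S)"
    using assms(4) by (simp only: supported_eq_span)
qed (use assms(3) in blast)

lemma linear_supported_image:
  assumes f: "chain_linear f" and "\<And>\<sigma>. \<sigma> \<in> S \<Longrightarrow> f (face \<sigma>) \<in> V" "chain.subspace V"
    and c: "c \<in> supported S"
  shows "f c \<in> V"
proof -
  have "f ` supported S \<subseteq> V"
    unfolding supported_eq_span chain_pair.linear_span_image[OF f, symmetric]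
    using assms(2,3) by (intro chain.span_minimal) auto
  then show ?thesis
    using c by blast
qed

lemma boundary_eq_lin_ext: "boundary = lin_ext simplex_boundary"
  by (simp add: fun_eq_iff boundary_def lin_ext_def)

lemma linear_boundary: "chain_linear boundary"
  unfolding boundary_eq_lin_ext by (rule linear_lin_ext)

lemma boundary_single: "boundary (Poly_Mapping.single \<sigma> a) = cscale a (simplex_boundary \<sigma>)"
  by (simp add: boundary_eq_lin_ext lin_ext_single)

lemma boundary_face: "boundary (face \<sigma>) = simplex_boundary \<sigma>"
  by (simp add: boundary_single)

abbreviation faces :: "'a set set \<Rightarrow> int \<Rightarrow> 'a set set" where
  "faces X i \<equiv> {\<sigma> \<in> X. \<sigma> \<noteq> {} \<and> int (card \<sigma>) = i + 1}"

lemma chains_eq_supported: "chains X i = supported (faces X i)"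
  by (auto simp: chains_def supported_def)

lemma subspace_chains: "chain.subspace (chains X i)"
  unfolding chains_eq_supported by (rule subspace_supported)

lemma chains_mono: "X \<subseteq> Y \<Longrightarrow> chains X i \<subseteq> chains Y i"
  by (auto simp: chains_def)

lemma boundaries_mono: "X \<subseteq> Y \<Longrightarrow> boundaries X i \<subseteq> boundaries Y i"
  unfolding boundaries_def by (intro image_mono chains_mono)

lemma subspace_boundaries: "chain.subspace (boundaries X i)"
  unfolding boundaries_def
  by (rule chain_pair.linear_subspace_image[OF linear_boundary subspace_chains])

lemma subspace_cycles: "chain.subspace (cycles X i)"
  unfolding cycles_def
  using chain.subspace_inter[OF subspace_chains chain_pair.linear_subspace_kernel[OF linear_boundary]]
  by (simp add: Int_def)

lemma chains_spanned:
  assumes "finite X"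
  obtains T where "finite T" "chains X i \<subseteq> chain.span T"
proof
  show "finite (face ` faces X i)"
    using assms by simp
  show "chains X i \<subseteq> chain.span (face ` faces X i)"
    by (simp add: chains_eq_supported supported_eq_span)
qed

definition incidence :: "'a set \<Rightarrow> 'a \<Rightarrow> 'f::field" where
  "incidence \<sigma> v = (-1) ^ card {w \<in> \<sigma>. w \<noteq> v \<and> (w, v) \<in> vertex_order}"

lemma simplex_boundary_incidence:
  "simplex_boundary \<sigma> = (\<Sum>v | v \<in> \<sigma> \<and> \<sigma> \<noteq> {v}. Poly_Mapping.single (\<sigma> - {v}) (incidence \<sigma> v))"
  by (simp add: simplex_boundary_def incidence_def)

lemma vertex_order_asym: "v \<noteq> w \<Longrightarrow> (w, v) \<in> vertex_order \<longleftrightarrow> (v, w) \<notin> vertex_order"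
  using linear_order_on_vertex_order
  by (auto simp: linear_order_on_def partial_order_on_def antisym_def total_on_def)

text \<open>
  Removing \<open>v\<close> moves the vertices after it up by one place.
\<close>

lemma incidence_remove:
  assumes "finite \<sigma>" "v \<in> \<sigma>" "v \<noteq> w"
  shows "incidence (\<sigma> - {v}) w = (if (v, w) \<in> vertex_order then - incidence \<sigma> w else incidence \<sigma> w)"
proof -
  let ?P = "{u \<in> \<sigma>. u \<noteq> w \<and> (u, w) \<in> vertex_order}"
  have e: "{u \<in> \<sigma> - {v}. u \<noteq> w \<and> (u, w) \<in> vertex_order} = ?P - {v}"
    by auto
  show ?thesis
  proof (cases "(v, w) \<in> vertex_order")
    case True
    then have c: "card ?P = Suc (card (?P - {v}))"
      using assms by (intro card.remove) auto
    show ?thesis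
      unfolding incidence_def e c by (simp only: True if_True power_Suc) simp
  next
    case False
    then have p: "?P - {v} = ?P"
      by auto
    show ?thesis
      unfolding incidence_def e p using False by simp
  qed
qed

text \<open>
  The face opposite to two vertices \<open>v\<close> and \<open>w\<close> is reached by deleting them in either order, with
  opposite signs. The pairs are split by the vertex order instead of arguing that the sum is its own
  negative, since the field may have characteristic two. Simplices with at most two vertices are
  treated separately, as their boundary involves the convention that drops the empty face.
\<close>

lemma boundary_simplex_boundary: "boundary (simplex_boundary \<sigma>) = (0 :: 'a set \<Rightarrow>\<^sub>0 'f::field)"
proof -
  interpret bd: Vector_Spaces.linear cscale cscale "boundary :: ('a set \<Rightarrow>\<^sub>0 'f) \<Rightarrow> _"
    by (rule linear_boundary)
  show ?thesis
  proof (cases "finite \<sigma> \<and> card \<sigma> \<ge> 3")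
    case False
    have "simplex_boundary (\<sigma> - {v}) = (0 :: 'a set \<Rightarrow>\<^sub>0 'f)" if fin: "finite \<sigma>" and v: "v \<in> \<sigma>" for v
    proof -
      have "card (\<sigma> - {v}) \<le> 1"
        using False fin v by simp
      then have "{w. w \<in> \<sigma> - {v} \<and> \<sigma> - {v} \<noteq> {w}} = {}"
        using fin card_le_Suc0_iff_eq[of "\<sigma> - {v}"] by auto
      then show ?thesis
        unfolding simplex_boundary_incidence by (metis (lifting) sum.empty)
    qed
    moreover have "{v. v \<in> \<sigma> \<and> \<sigma> \<noteq> {v}} = \<sigma>" if "infinite \<sigma>"
      using that by auto
    ultimately show ?thesis
      by (cases "finite \<sigma>") (auto simp: simplex_boundary_incidence[of \<sigma>] bd.sum boundary_single)
  next
    case True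
    then have fin: "finite \<sigma>" and big: "card \<sigma> \<ge> 3"
      by auto
    have ne1: "\<sigma> \<noteq> {v}" for v
      using big by auto
    have ne2: "\<sigma> - {v} \<noteq> {w}" for v w
    proof
      assume "\<sigma> - {v} = {w}"
      then have "\<sigma> \<subseteq> {v, w}"
        by blast
      then have "card \<sigma> \<le> card {v, w}"
        by (intro card_mono) auto
      also have "\<dots> \<le> 2"
        by (simp add: card_insert_if)
      finally show False
        using big by simp
    qed
    define T :: "'a \<Rightarrow> 'a \<Rightarrow> ('a set \<Rightarrow>\<^sub>0 'f)" where
      "T v w = Poly_Mapping.single (\<sigma> - {v} - {w}) (incidence \<sigma> v * incidence (\<sigma> - {v}) w)" for v w
    let ?R = "\<lambda>v w. v \<noteq> w \<and> (v, w) \<in> vertex_order"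
    have anti: "T w v = - T v w" if "v \<in> \<sigma>" "w \<in> \<sigma>" "?R v w" for v w
    proof -
      have "(w, v) \<notin> vertex_order"
        using that vertex_order_asym by metis
      then have "incidence \<sigma> w * incidence (\<sigma> - {w}) v = - (incidence \<sigma> v * incidence (\<sigma> - {v}) w :: 'f)"
        using that not_sym[of v w] by (simp add: incidence_remove[OF fin])
      moreover have "\<sigma> - {w} - {v} = \<sigma> - {v} - {w}"
        by auto
      ultimately show ?thesis
        unfolding T_def by (simp add: single_uminus)
    qed
    have diff: "{w \<in> \<sigma>. w \<noteq> v} = \<sigma> - {v}" for v
      by auto
    have "boundary (simplex_boundary \<sigma>) = (\<Sum>v\<in>\<sigma>. \<Sum>w\<in>\<sigma> - {v}. T v w)"
      by (simp add: simplex_boundary_incidence bd.sum boundary_single ne1 ne2 chain.scale_sum_right cscale_single T_def diff)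
    also have "\<dots> = (\<Sum>v\<in>\<sigma>. (\<Sum>w\<in>{w \<in> \<sigma>. ?R v w}. T v w) + (\<Sum>w\<in>{w \<in> \<sigma>. ?R w v}. T v w))"
    proof (rule sum.cong[OF refl])
      fix v assume "v \<in> \<sigma>"
      have "\<sigma> - {v} = {w \<in> \<sigma>. ?R v w} \<union> {w \<in> \<sigma>. ?R w v}"
        using vertex_order_asym[of v] by auto
      moreover have "{w \<in> \<sigma>. ?R v w} \<inter> {w \<in> \<sigma>. ?R w v} = {}"
        using vertex_order_asym[of v] by auto
      ultimately show "(\<Sum>w\<in>\<sigma> - {v}. T v w) =
          (\<Sum>w\<in>{w \<in> \<sigma>. ?R v w}. T v w) + (\<Sum>w\<in>{w \<in> \<sigma>. ?R w v}. T v w)"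
        using fin sum.union_disjoint[of "{w \<in> \<sigma>. ?R v w}" "{w \<in> \<sigma>. ?R w v}" "T v"] by simp
    qed
    also have "\<dots> = (\<Sum>v\<in>\<sigma>. \<Sum>w\<in>{w \<in> \<sigma>. ?R v w}. T v w) + (\<Sum>v\<in>\<sigma>. \<Sum>w\<in>{w \<in> \<sigma>. ?R w v}. T v w)"
      by (rule sum.distrib)
    also have "(\<Sum>v\<in>\<sigma>. \<Sum>w\<in>{w \<in> \<sigma>. ?R w v}. T v w) = (\<Sum>w\<in>\<sigma>. \<Sum>v\<in>{v \<in> \<sigma>. ?R w v}. T v w)"
      by (rule sum.swap_restrict[OF fin fin])
    also have "\<dots> = (\<Sum>w\<in>\<sigma>. \<Sum>v\<in>{v \<in> \<sigma>. ?R w v}. - T w v)"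
      by (intro sum.cong refl) (use anti in auto)
    finally show ?thesis
      by (simp add: sum_negf)
  qed
qed

lemma boundary_boundary: "boundary (boundary c) = 0"
proof -
  have "boundary (boundary c) = 0"
    if "c \<in> supported (Poly_Mapping.keys c)"
    using linear_supported_image[of "boundary \<circ> boundary" "Poly_Mapping.keys c" "{0}" c]
      Vector_Spaces.linear_compose[OF linear_boundary linear_boundary] that
    by (simp add: boundary_face boundary_simplex_boundary)
  then show ?thesis
    by (simp add: supported_def)
qed

lemma keys_simplex_boundary:
  "Poly_Mapping.keys (simplex_boundary \<sigma>) \<subseteq> {\<sigma> - {v} | v. v \<in> \<sigma> \<and> \<sigma> \<noteq> {v}}"
  unfolding simplex_boundary_incidence
  by (rule order_trans[OF Poly_Mapping.keys_sum]) auto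

lemma complex_subset: "simplicial_complex X \<Longrightarrow> \<sigma> \<in> X \<Longrightarrow> \<tau> \<subseteq> \<sigma> \<Longrightarrow> \<tau> \<in> X"
  by (auto simp: simplicial_complex_def)

lemma boundary_in_chains:
  assumes "simplicial_complex X" "c \<in> chains X i"
  shows "boundary c \<in> chains X (i - 1)"
proof (rule linear_supported_image[OF linear_boundary _ subspace_chains])
  show "c \<in> supported (faces X i)"
    using assms(2) by (simp add: chains_eq_supported)
  fix \<sigma> assume \<sigma>: "\<sigma> \<in> faces X i"
  then have "finite \<sigma>"
    using assms(1) by (auto simp: simplicial_complex_def)
  then have "{\<sigma> - {v} | v. v \<in> \<sigma> \<and> \<sigma> \<noteq> {v}} \<subseteq> faces X (i - 1)"
    using \<sigma> complex_subset[OF assms(1)] card_gt_0_iff[of \<sigma>] by (auto simp: of_nat_diff)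
  then show "boundary (face \<sigma>) \<in> chains X (i - 1)"
    unfolding boundary_face chains_eq_supported supported_def
    by (intro CollectI order_trans[OF keys_simplex_boundary])
qed

lemma boundaries_subset_cycles:
  assumes "simplicial_complex X"
  shows "boundaries X i \<subseteq> cycles X i"
  using boundary_in_chains[OF assms, of _ "i + 1"]
  by (auto simp: boundaries_def cycles_def boundary_boundary)

section \<open>Betti numbers as ranks\<close>

text \<open>
  The rank of the boundary map into degree \<open>i\<close>. Alternating sums of Betti numbers telescope when
  written in these ranks, leaving only one of them.
\<close>

definition rk :: "'f::field itself \<Rightarrow> 'a set set \<Rightarrow> int \<Rightarrow> nat" where
  "rk F X i = chain.dim (boundaries X i :: ('a set \<Rightarrow>\<^sub>0 'f) set)"

lemma class_eq:
  assumes "c \<in> cycles X i"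
  shows "homologous X i `` {c} = {c' \<in> cycles X i. c - c' \<in> boundaries X i}"
  using assms by (auto simp: homologous_def)

text \<open>
  Independent classes correspond, through any choice of representatives, to families of cycles that
  are independent modulo the boundaries. So the maximum defining the Betti number is the dimension
  of cycles modulo boundaries.
\<close>

lemma betti_quotient:
  fixes F :: "'f::field itself" and X :: "'a set set"
  assumes X: "simplicial_complex X"
  shows "betti F X i + rk F X i = chain.dim (cycles X i :: ('a set \<Rightarrow>\<^sub>0 'f) set)"
proof -
  let ?Z = "cycles X i :: ('a set \<Rightarrow>\<^sub>0 'f) set" and ?B = "boundaries X i :: ('a set \<Rightarrow>\<^sub>0 'f) set"
  let ?cl = "\<lambda>z. homologous X i `` {z :: 'a set \<Rightarrow>\<^sub>0 'f}"
  have fin: "finite X"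
    using X by (simp add: simplicial_complex_def)
  obtain T :: "('a set \<Rightarrow>\<^sub>0 'f) set" where T: "finite T" "chains X i \<subseteq> chain.span T"
    using chains_spanned[OF fin] by blast
  then have ZT: "?Z \<subseteq> chain.span T"
    by (auto simp: cycles_def)
  note BZ = subspace_boundaries boundaries_subset_cycles[OF X] subspace_cycles ZT T(1)
  have le: "card S + rk F X i \<le> chain.dim ?Z"
    if S: "independent_classes X i (S :: ('a set \<Rightarrow>\<^sub>0 'f) set set)" for S
  proof -
    define r where "r C = (SOME c. c \<in> C)" for C :: "('a set \<Rightarrow>\<^sub>0 'f) set"
    have SH: "\<exists>z\<in>?Z. C = ?cl z" if "C \<in> S" for C
      using S that by (auto simp: independent_classes_def homology_def quotient_def)
    have r: "r C \<in> C \<and> r C \<in> ?Z" if C: "C \<in> S" for C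
    proof -
      obtain z where z: "z \<in> ?Z" "C = ?cl z"
        using SH[OF C] by blast
      then have "z \<in> C"
        using chain.subspace_0[OF subspace_boundaries] by (auto simp: class_eq)
      then have "r C \<in> C"
        unfolding r_def by (rule someI)
      then show ?thesis
        using z by (auto simp: class_eq)
    qed
    show ?thesis
      unfolding rk_def
    proof (rule chain.card_independent_mod_le[OF BZ, of S r])
      fix a assume "(\<Sum>s\<in>S. cscale (a s) (r s)) \<in> ?B"
      then show "\<forall>s\<in>S. a s = 0"
        using S r unfolding independent_classes_def by blast
    qed (use S r in \<open>auto simp: independent_classes_def\<close>)
  qed
  obtain S where S: "finite S" "S \<subseteq> ?Z" "card S + chain.dim ?B = chain.dim ?Z"
    "\<And>a. (\<Sum>s\<in>S. cscale (a s) s) \<in> ?B \<Longrightarrow> (\<forall>s\<in>S. a s = 0)"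
    using chain.ex_independent_mod[OF BZ, of "\<exists>S. finite S \<and> S \<subseteq> ?Z \<and>
      card S + chain.dim ?B = chain.dim ?Z \<and>
      (\<forall>a. (\<Sum>s\<in>S. cscale (a s) s) \<in> ?B \<longrightarrow> (\<forall>s\<in>S. a s = 0))"] by blast
  have inj: "inj_on ?cl S"
  proof (rule inj_onI, rule ccontr)
    fix z z' assume z: "z \<in> S" "z' \<in> S" "?cl z = ?cl z'" "z \<noteq> z'"
    have "(z', z') \<in> homologous X i"
      using z(2) S(2) chain.subspace_0[OF subspace_boundaries] by (auto simp: homologous_def)
    then have "z' \<in> ?cl z"
      using z(3) by blast
    then have "z - z' \<in> ?B"
      by (auto simp: homologous_def)
    moreover have "(\<Sum>s\<in>S. cscale (if s = z then 1 else if s = z' then -1 else 0) s) = z - z'"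
    proof -
      have "(\<Sum>s\<in>S. cscale (if s = z then 1 else if s = z' then -1 else 0) s)
          = (\<Sum>s\<in>S. (if s = z then z else 0) + (if s = z' then - z' else 0))"
        using z(4) by (intro sum.cong) auto
      also have "\<dots> = z - z'"
        using S(1) z by (simp add: sum.distrib)
      finally show ?thesis .
    qed
    ultimately have "(\<Sum>s\<in>S. cscale (if s = z then 1 else if s = z' then -1 else 0) s) \<in> ?B"
      by simp
    from bspec[OF S(4)[OF this] z(1)] show False
      by simp
  qed
  have "independent_classes X i (?cl ` S)"
    unfolding independent_classes_def
  proof (intro conjI allI impI)
    show "?cl ` S \<subseteq> homology X i"
      using S(2) by (auto simp: homology_def quotient_def)
    fix a :: "('a set \<Rightarrow>\<^sub>0 'f) set \<Rightarrow> 'f" and r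
    assume ar: "(\<forall>C\<in>?cl ` S. r C \<in> C) \<and> (\<Sum>C\<in>?cl ` S. cscale (a C) (r C)) \<in> ?B"
    have "s - r (?cl s) \<in> ?B" if "s \<in> S" for s
      using ar that S(2) by (auto simp: homologous_def)
    then have "(\<Sum>s\<in>S. cscale (a (?cl s)) (s - r (?cl s))) \<in> ?B"
      by (intro chain.subspace_sum[OF subspace_boundaries] chain.subspace_scale[OF subspace_boundaries])
    moreover have "(\<Sum>s\<in>S. cscale (a (?cl s)) (r (?cl s))) \<in> ?B"
      using ar by (simp add: sum.reindex[OF inj])
    ultimately have "(\<Sum>s\<in>S. cscale (a (?cl s)) (s - r (?cl s))) + (\<Sum>s\<in>S. cscale (a (?cl s)) (r (?cl s))) \<in> ?B"
      by (rule chain.subspace_add[OF subspace_boundaries])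
    then have "(\<Sum>s\<in>S. cscale (a (?cl s)) s) \<in> ?B"
      by (simp add: sum.distrib[symmetric] chain.scale_right_distrib[symmetric])
    then show "\<forall>C\<in>?cl ` S. a C = 0"
      using S(4)[of "\<lambda>s. a (?cl s)"] by blast
  qed (use S(1) in simp)
  then have "card S \<in> card ` {S :: ('a set \<Rightarrow>\<^sub>0 'f) set set. independent_classes X i S}"
    using card_image[OF inj] by (intro image_eqI[of _ _ "?cl ` S"]) auto
  moreover have max: "n \<le> card S" if "n \<in> card ` {S :: ('a set \<Rightarrow>\<^sub>0 'f) set set. independent_classes X i S}" for n
    using that le S(3) by (fastforce simp: rk_def)
  moreover have "finite (card ` {S :: ('a set \<Rightarrow>\<^sub>0 'f) set set. independent_classes X i S})"
    by (rule finite_subset[of _ "{..card S}"]) (use max in auto)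
  ultimately have "betti F X i = card S"
    unfolding betti_def by (intro Max_eqI) auto
  then show ?thesis
    using S(3) by (simp add: rk_def)
qed

lemma betti_ranks:
  fixes F :: "'f::field itself" and X :: "'a set set"
  assumes X: "simplicial_complex X"
  shows "betti F X i + rk F X i + rk F X (i - 1) = card (faces X i)"
proof -
  have fin: "finite X"
    using X by (simp add: simplicial_complex_def)
  obtain T :: "('a set \<Rightarrow>\<^sub>0 'f) set" where T: "finite T" "chains X i \<subseteq> chain.span T"
    using chains_spanned[OF fin] by blast
  have "chain.dim (chains X i :: ('a set \<Rightarrow>\<^sub>0 'f) set) = rk F X (i - 1) + chain.dim (cycles X i :: ('a set \<Rightarrow>\<^sub>0 'f) set)"
    using chain.rank_nullity[OF linear_boundary subspace_chains T(2,1)]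
    by (simp add: rk_def boundaries_def cycles_def)
  then show ?thesis
    using betti_quotient[OF X, of F i] dim_supported[of "faces X i", where 'f = 'f] fin
    by (simp add: chains_eq_supported)
qed

text \<open>
  Injectivity of a linear map is triviality of its kernel, and the kernel consists of the classes of
  those chains of \<open>Y\<close> that bound in \<open>X\<close>; such chains are automatically cycles.
\<close>

lemma inj_on_inclusion_hom_iff:
  fixes X Y :: "'a set set"
  assumes X: "simplicial_complex X" and Y: "simplicial_complex Y" and YX: "Y \<subseteq> X"
  shows "inj_on (inclusion_hom X i) (homology Y i :: ('a set \<Rightarrow>\<^sub>0 'f::field) set set)
     \<longleftrightarrow> boundaries X i \<inter> chains Y i \<subseteq> (boundaries Y i :: ('a set \<Rightarrow>\<^sub>0 'f) set)"
    (is "?L \<longleftrightarrow> ?R")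
proof -
  let ?BX = "boundaries X i :: ('a set \<Rightarrow>\<^sub>0 'f) set" and ?BY = "boundaries Y i :: ('a set \<Rightarrow>\<^sub>0 'f) set"
  have BYX: "?BY \<subseteq> ?BX"
    by (rule boundaries_mono[OF YX])
  have ZYX: "cycles Y i \<subseteq> cycles X i"
    using chains_mono[OF YX] by (auto simp: cycles_def)
  have add: "a + b \<in> ?BX" if "a \<in> ?BX" "b \<in> ?BX" for a b
    using that by (rule chain.subspace_add[OF subspace_boundaries])
  have neg: "b - a \<in> boundaries W i" if "a - b \<in> boundaries W i" for a b :: "'a set \<Rightarrow>\<^sub>0 'f" and W
    using chain.subspace_neg[OF subspace_boundaries that] by simp
  have incl: "inclusion_hom X i (homologous Y i `` {c}) = homologous X i `` {c}"
    if "c \<in> cycles Y i" for c :: "'a set \<Rightarrow>\<^sub>0 'f"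
  proof
    show "inclusion_hom X i (homologous Y i `` {c}) \<subseteq> homologous X i `` {c}"
      using that ZYX BYX add[of "c - _" "_ - _"] unfolding inclusion_hom_def
      by (fastforce simp: homologous_def)
    show "homologous X i `` {c} \<subseteq> inclusion_hom X i (homologous Y i `` {c})"
    proof
      fix e assume "e \<in> homologous X i `` {c}"
      moreover have "(c, c) \<in> homologous Y i"
        using that chain.subspace_0[OF subspace_boundaries] by (simp add: homologous_def)
      ultimately show "e \<in> inclusion_hom X i (homologous Y i `` {c})"
        by (auto simp: inclusion_hom_def)
    qed
  qed
  have cl_eq: "homologous W i `` {c} = homologous W i `` {c'} \<longleftrightarrow> c - c' \<in> boundaries W i"
    if cc: "c \<in> cycles W i" "c' \<in> cycles W i" for c c' :: "'a set \<Rightarrow>\<^sub>0 'f" and W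
  proof
    assume "homologous W i `` {c} = homologous W i `` {c'}"
    moreover have "c' \<in> homologous W i `` {c'}"
      using cc chain.subspace_0[OF subspace_boundaries] by (auto simp: class_eq)
    ultimately show "c - c' \<in> boundaries W i"
      by (auto simp: homologous_def)
  next
    assume d: "c - c' \<in> boundaries W i"
    have "c - e \<in> boundaries W i \<longleftrightarrow> c' - e \<in> boundaries W i" for e
      using chain.subspace_add[OF subspace_boundaries d, of "c' - e"]
        chain.subspace_diff[OF subspace_boundaries _ d, of "c - e"] by auto
    then show "homologous W i `` {c} = homologous W i `` {c'}"
      using cc by (simp add: class_eq)
  qed
  show ?thesis
  proof
    assume L: ?L
    show ?R
    proof
      fix c assume c: "c \<in> ?BX \<inter> chains Y i"
      then have cZ: "c \<in> cycles Y i"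
        by (auto simp: cycles_def boundaries_def boundary_boundary)
      have 0: "0 \<in> cycles Y i"
        by (rule chain.subspace_0[OF subspace_cycles])
      have "homologous X i `` {c} = homologous X i `` {0}"
        using c cZ 0 ZYX cl_eq[of c X 0] by auto
      then have "inclusion_hom X i (homologous Y i `` {c}) = inclusion_hom X i (homologous Y i `` {0})"
        unfolding incl[OF cZ] incl[OF 0] .
      from L this have "homologous Y i `` {c} = homologous Y i `` {0}"
        unfolding homology_def by (rule inj_onD) (rule quotientI[OF cZ], rule quotientI[OF 0])
      then show "c \<in> ?BY"
        using cl_eq[OF cZ 0] by simp
    qed
  next
    assume R: ?R
    show ?L
    proof (rule inj_onI)
      fix C C' :: "('a set \<Rightarrow>\<^sub>0 'f) set"
      assume C: "C \<in> homology Y i" "C' \<in> homology Y i" "inclusion_hom X i C = inclusion_hom X i C'"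
      obtain c c' where c: "c \<in> cycles Y i" "C = homologous Y i `` {c}"
        "c' \<in> cycles Y i" "C' = homologous Y i `` {c'}"
        using C(1,2) unfolding homology_def by (auto elim!: quotientE)
      have "c - c' \<in> ?BX"
        using C(3) c ZYX cl_eq[of c X c'] by (auto simp: incl)
      moreover have "c - c' \<in> chains Y i"
        using chain.subspace_diff[OF subspace_chains, of c Y i c'] c by (auto simp: cycles_def)
      ultimately have "c - c' \<in> ?BY"
        using R by blast
      then show "C = C'"
        using cl_eq[OF c(1,3)] c by simp
    qed
  qed
qed

section \<open>Removing a vertex\<close>

lemma chain_linear_compose: "chain_linear f \<Longrightarrow> chain_linear g \<Longrightarrow> chain_linear (g \<circ> f)"
  by (rule Vector_Spaces.linear_compose)

lemma finite_lk:
  assumes "simplicial_complex X"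
  shows "finite (lk x X)"
  using assms by (intro finite_imageD[of "insert x" "lk x X"] finite_subset[of "insert x ` lk x X" X])
    (auto simp: simplicial_complex_def lk_def inj_on_def)

text \<open>
  The projection of a chain to the simplices that contain \<open>x\<close>: a model, inside the chains of a complex,
  of the quotient map to the chains relative to the subcomplex of simplices that avoid \<open>x\<close>.
\<close>

definition star_part :: "'a \<Rightarrow> ('a set \<Rightarrow>\<^sub>0 'f::field) \<Rightarrow> ('a set \<Rightarrow>\<^sub>0 'f)" where
  "star_part x = lin_ext (\<lambda>\<sigma>. if x \<in> \<sigma> then face \<sigma> else 0)"

lemma linear_star_part: "chain_linear (star_part x)"
  unfolding star_part_def by (rule linear_lin_ext)

lemma lookup_star_part:
  "Poly_Mapping.lookup (star_part x c) \<tau> = (if x \<in> \<tau> then Poly_Mapping.lookup c \<tau> else 0)"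
proof -
  have "Poly_Mapping.lookup (star_part x c) \<tau>
      = (\<Sum>\<sigma>\<in>Poly_Mapping.keys c. if \<sigma> = \<tau> then (if x \<in> \<tau> then Poly_Mapping.lookup c \<tau> else 0) else 0)"
    unfolding star_part_def lin_ext_def lookup_sum
    by (rule sum.cong) (auto simp: lookup_cscale lookup_single when_def)
  then show ?thesis
    by (auto simp: in_keys_iff)
qed

lemma star_part_eq_0_iff: "star_part x c = 0 \<longleftrightarrow> c \<in> supported {\<sigma>. x \<notin> \<sigma>}"
  by (auto simp: poly_mapping_eq_iff fun_eq_iff lookup_star_part supported_def in_keys_iff)

lemma keys_star_part: "Poly_Mapping.keys (star_part x c) = {\<sigma> \<in> Poly_Mapping.keys c. x \<in> \<sigma>}"
  by (auto simp: in_keys_iff lookup_star_part split: if_splits)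

text \<open>
  The sign that makes \<open>cone\<close> commute with boundaries without a further sign (see
  \<open>star_part_boundary_cone\<close>): it counts the transpositions that bring \<open>x\<close> to the last place.
\<close>

definition cone_sign :: "'a \<Rightarrow> 'a set \<Rightarrow> 'f::field" where
  "cone_sign x \<sigma> = (-1) ^ card {w \<in> \<sigma>. (x, w) \<in> vertex_order}"

definition cone :: "'a \<Rightarrow> ('a set \<Rightarrow>\<^sub>0 'f::field) \<Rightarrow> ('a set \<Rightarrow>\<^sub>0 'f)" where
  "cone x = lin_ext (\<lambda>\<sigma>. Poly_Mapping.single (insert x \<sigma>) (cone_sign x \<sigma>))"

definition uncone :: "'a \<Rightarrow> ('a set \<Rightarrow>\<^sub>0 'f::field) \<Rightarrow> ('a set \<Rightarrow>\<^sub>0 'f)" where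
  "uncone x = lin_ext (\<lambda>\<sigma>. Poly_Mapping.single (\<sigma> - {x}) (cone_sign x (\<sigma> - {x})))"

lemma linear_cone: "chain_linear (cone x)"
  unfolding cone_def by (rule linear_lin_ext)

lemma linear_uncone: "chain_linear (uncone x)"
  unfolding uncone_def by (rule linear_lin_ext)

lemma cone_sign_square: "cone_sign x \<sigma> * cone_sign x \<sigma> = 1"
  by (simp add: cone_sign_def flip: power_add mult_2)

lemma cone_sign_nonzero: "cone_sign x \<sigma> \<noteq> 0"
  by (simp add: cone_sign_def)

lemma cone_single: "cone x (Poly_Mapping.single \<sigma> a) = Poly_Mapping.single (insert x \<sigma>) (a * cone_sign x \<sigma>)"
  by (simp add: cone_def lin_ext_single cscale_single)

lemma uncone_single:
  "uncone x (Poly_Mapping.single \<sigma> a) = Poly_Mapping.single (\<sigma> - {x}) (a * cone_sign x (\<sigma> - {x}))"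
  by (simp add: uncone_def lin_ext_single cscale_single)

lemma uncone_cone:
  assumes "c \<in> supported {\<sigma>. x \<notin> \<sigma>}"
  shows "uncone x (cone x c) = c"
proof -
  have "(uncone x \<circ> cone x) c = id c"
    by (rule linear_eq_on_supported[OF chain_linear_compose[OF linear_cone linear_uncone]
          chain.linear_id _ assms])
      (auto simp: cone_single uncone_single cone_sign_square)
  then show ?thesis
    by simp
qed

lemma cone_uncone:
  assumes "c \<in> supported {\<sigma>. x \<in> \<sigma>}"
  shows "cone x (uncone x c) = c"
proof -
  have "(cone x \<circ> uncone x) c = id c"
    by (rule linear_eq_on_supported[OF chain_linear_compose[OF linear_uncone linear_cone]
          chain.linear_id _ assms])
      (auto simp: cone_single uncone_single cone_sign_square insert_absorb)
  then show ?thesis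
    by simp
qed

lemma incidence_nonzero: "incidence \<sigma> v \<noteq> 0"
  by (simp add: incidence_def)

text \<open>
  The face opposite to \<open>x\<close> is the only one lost in the projection. The case of a single vertex is
  included, where the augmentation takes the place of the boundary in \<open>\<sigma>\<close>.
\<close>

lemma star_part_boundary_cone_face:
  assumes "finite \<sigma>" "x \<notin> \<sigma>" "\<sigma> \<noteq> {}"
  shows "star_part x (boundary (cone x (face \<sigma>))) =
    (\<Sum>v\<in>\<sigma>. Poly_Mapping.single (insert x (\<sigma> - {v})) (cone_sign x \<sigma> * incidence (insert x \<sigma>) v :: 'f::field))"
proof -
  interpret st: Vector_Spaces.linear cscale cscale "star_part x :: ('a set \<Rightarrow>\<^sub>0 'f) \<Rightarrow> _"
    by (rule linear_star_part)
  have st_single: "star_part x (Poly_Mapping.single \<tau> a :: 'a set \<Rightarrow>\<^sub>0 'f)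
      = (if x \<in> \<tau> then Poly_Mapping.single \<tau> a else 0)" for \<tau> a
    by (simp add: star_part_def lin_ext_single cscale_single)
  have ix: "{v. v \<in> insert x \<sigma> \<and> insert x \<sigma> \<noteq> {v}} = insert x \<sigma>"
    using assms by auto
  have "star_part x (simplex_boundary (insert x \<sigma>)) =
      (\<Sum>v\<in>insert x \<sigma>. star_part x (Poly_Mapping.single (insert x \<sigma> - {v}) (incidence (insert x \<sigma>) v :: 'f)))"
    unfolding simplex_boundary_incidence ix by (rule st.sum)
  also have "\<dots> = (\<Sum>v\<in>\<sigma>. star_part x (Poly_Mapping.single (insert x \<sigma> - {v}) (incidence (insert x \<sigma>) v)))"
    using assms by (simp add: st_single)
  also have "\<dots> = (\<Sum>v\<in>\<sigma>. Poly_Mapping.single (insert x (\<sigma> - {v})) (incidence (insert x \<sigma>) v))"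
  proof (rule sum.cong[OF refl])
    fix v assume "v \<in> \<sigma>"
    then have "insert x \<sigma> - {v} = insert x (\<sigma> - {v})"
      using assms(2) by auto
    then show "star_part x (Poly_Mapping.single (insert x \<sigma> - {v}) (incidence (insert x \<sigma>) v :: 'f))
        = Poly_Mapping.single (insert x (\<sigma> - {v})) (incidence (insert x \<sigma>) v)"
      by (simp add: st_single)
  qed
  finally show ?thesis
    by (simp add: cone_single boundary_single st.scale chain.scale_sum_right cscale_single)
qed

text \<open>
  Modulo the simplices that avoid \<open>x\<close>, the boundary of a cone is the cone on the boundary: relative
  chains of a complex are the chains of the link, one degree lower. The bound on the cardinality is
  there because the boundary of a vertex is zero here, while the cone on the empty face is not.
\<close>

lemma star_part_boundary_cone:
  assumes "c \<in> supported {\<sigma>. finite \<sigma> \<and> x \<notin> \<sigma> \<and> 2 \<le> card \<sigma>}"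
  shows "star_part x (boundary (cone x c)) = cone x (boundary (c :: 'a set \<Rightarrow>\<^sub>0 'f::field))"
proof -
  interpret co: Vector_Spaces.linear cscale cscale "cone x :: ('a set \<Rightarrow>\<^sub>0 'f) \<Rightarrow> _"
    by (rule linear_cone)
  have "(star_part x \<circ> (boundary \<circ> cone x)) c = (cone x \<circ> boundary) c"
  proof (rule linear_eq_on_supported[OF _ _ _ assms])
    fix \<sigma> assume "\<sigma> \<in> {\<sigma>. finite \<sigma> \<and> x \<notin> \<sigma> \<and> 2 \<le> card \<sigma>}"
    then have \<sigma>: "finite \<sigma>" "x \<notin> \<sigma>" "2 \<le> card \<sigma>"
      by auto
    then have "\<sigma> \<noteq> {}" "{v. v \<in> \<sigma> \<and> \<sigma> \<noteq> {v}} = \<sigma>"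
      by auto
    moreover have "cone_sign x (\<sigma> - {v}) * incidence \<sigma> v = (cone_sign x \<sigma> * incidence (insert x \<sigma>) v :: 'f)"
      if v: "v \<in> \<sigma>" for v
    proof -
      have ne: "x \<noteq> v"
        using \<sigma>(2) v by auto
      have inc: "incidence \<sigma> v = (if (x, v) \<in> vertex_order then - incidence (insert x \<sigma>) v
          else incidence (insert x \<sigma>) v :: 'f)"
        using incidence_remove[of "insert x \<sigma>" x v] \<sigma> ne by simp
      have "cone_sign x \<sigma> = (if (x, v) \<in> vertex_order then - cone_sign x (\<sigma> - {v})
          else cone_sign x (\<sigma> - {v}) :: 'f)"
      proof -
        let ?P = "{w \<in> \<sigma>. (x, w) \<in> vertex_order}"
        have e: "{w \<in> \<sigma> - {v}. (x, w) \<in> vertex_order} = ?P - {v}"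
          by auto
        show ?thesis
        proof (cases "(x, v) \<in> vertex_order")
          case True
          then have c: "card ?P = Suc (card (?P - {v}))"
            using \<sigma>(1) v by (intro card.remove) auto
          show ?thesis
            unfolding cone_sign_def e c by (simp only: True if_True power_Suc) simp
        next
          case False
          then have p: "?P - {v} = ?P"
            by auto
          show ?thesis
            unfolding cone_sign_def e p using False by simp
        qed
      qed
      then show ?thesis
        by (simp add: inc)
    qed
    ultimately show "(star_part x \<circ> (boundary \<circ> cone x)) (face \<sigma>) = (cone x \<circ> boundary) (face \<sigma> :: 'a set \<Rightarrow>\<^sub>0 'f)"
      using star_part_boundary_cone_face[of \<sigma> x, where 'f = 'f] \<sigma>
      by (simp add: boundary_face simplex_boundary_incidence co.sum cone_single mult.commute)
  qed (intro chain_linear_compose linear_cone linear_boundary linear_star_part)+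
  then show ?thesis
    by simp
qed

lemma star_part_boundary_free:
  assumes "c \<in> supported {\<sigma>. x \<notin> \<sigma>}"
  shows "star_part x (boundary c) = 0"
  unfolding star_part_eq_0_iff
proof (rule linear_supported_image[OF linear_boundary _ subspace_supported assms])
  fix \<sigma> assume "\<sigma> \<in> {\<sigma>. x \<notin> \<sigma>}"
  then show "boundary (face \<sigma>) \<in> supported {\<sigma>. x \<notin> \<sigma>}"
    unfolding boundary_face supported_def
    by (intro CollectI order_trans[OF keys_simplex_boundary]) auto
qed

text \<open>
  Up to chains that avoid \<open>x\<close>, every chain of \<open>Y\<close> of positive degree is a cone over a chain of the
  link. Degree zero would differ: the vertex \<open>x\<close> is the cone over the empty face.
\<close>

lemma star_part_boundaries:
  assumes Y: "simplicial_complex Y"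
  shows "star_part x ` boundaries Y (int j)
    = (\<lambda>c. star_part x (boundary (cone x c))) ` (chains (lk x Y) (int j) :: ('a set \<Rightarrow>\<^sub>0 'f::field) set)"
proof
  have fin: "finite \<sigma>" if "\<sigma> \<in> Y" for \<sigma>
    using Y that by (auto simp: simplicial_complex_def)
  interpret bd: Vector_Spaces.linear cscale cscale "boundary :: ('a set \<Rightarrow>\<^sub>0 'f) \<Rightarrow> _"
    by (rule linear_boundary)
  interpret st: Vector_Spaces.linear cscale cscale "star_part x :: ('a set \<Rightarrow>\<^sub>0 'f) \<Rightarrow> _"
    by (rule linear_star_part)
  show "star_part x ` boundaries Y (int j)
    \<subseteq> (\<lambda>c. star_part x (boundary (cone x c))) ` (chains (lk x Y) (int j) :: ('a set \<Rightarrow>\<^sub>0 'f::field) set)"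
  proof
    fix b :: "'a set \<Rightarrow>\<^sub>0 'f" assume "b \<in> star_part x ` boundaries Y (int j)"
    then obtain c :: "'a set \<Rightarrow>\<^sub>0 'f" where c: "c \<in> chains Y (int j + 1)" "b = star_part x (boundary c)"
      by (auto simp: boundaries_def)
    \<comment> \<open>Only the part of \<open>c\<close> in the star of \<open>x\<close> contributes, and that part is a cone.\<close>
    have "star_part x (c - star_part x c) = 0"
      by (auto intro!: poly_mapping_eqI simp: lookup_star_part lookup_minus)
    then have "star_part x (boundary (c - star_part x c)) = 0"
      by (intro star_part_boundary_free) (simp add: star_part_eq_0_iff)
    then have b: "b = star_part x (boundary (star_part x c))"
      by (simp add: c(2) bd.diff st.diff)
    have k: "star_part x c \<in> supported {\<sigma> \<in> faces Y (int j + 1). x \<in> \<sigma>}"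
      using c(1) by (auto simp: chains_def supported_def keys_star_part)
    have "uncone x (star_part x c) \<in> chains (lk x Y) (int j)"
    proof (rule linear_supported_image[OF linear_uncone _ subspace_chains k])
      fix \<sigma> assume \<sigma>: "\<sigma> \<in> {\<sigma> \<in> faces Y (int j + 1). x \<in> \<sigma>}"
      then have "card (\<sigma> - {x}) = Suc j"
        using fin[of \<sigma>] by (subst card_Diff_singleton) auto
      moreover from this have "\<sigma> - {x} \<noteq> {}"
        by (metis card.empty nat.distinct(1))
      ultimately show "uncone x (face \<sigma>) \<in> chains (lk x Y) (int j)"
        using \<sigma> unfolding uncone_single chains_def lk_def by (auto simp: insert_absorb)
    qed
    moreover have "cone x (uncone x (star_part x c)) = star_part x c"
      using k by (intro cone_uncone) (auto simp: supported_def)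
    ultimately show "b \<in> (\<lambda>c. star_part x (boundary (cone x c))) ` chains (lk x Y) (int j)"
      using b by (metis image_eqI)
  qed
  show "(\<lambda>c. star_part x (boundary (cone x c))) ` (chains (lk x Y) (int j) :: ('a set \<Rightarrow>\<^sub>0 'f::field) set)
    \<subseteq> star_part x ` boundaries Y (int j)"
  proof (rule image_subsetI)
    fix c :: "'a set \<Rightarrow>\<^sub>0 'f" assume c: "c \<in> chains (lk x Y) (int j)"
    have "cone x c \<in> chains Y (int j + 1)"
    proof (rule linear_supported_image[OF linear_cone _ subspace_chains])
      show "c \<in> supported (faces (lk x Y) (int j))"
        using c by (simp add: chains_eq_supported)
      fix \<sigma> assume "\<sigma> \<in> faces (lk x Y) (int j)"
      then have "insert x \<sigma> \<in> Y" "x \<notin> \<sigma>" "int (card \<sigma>) = int j + 1"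
        by (auto simp: lk_def)
      then show "cone x (face \<sigma>) \<in> chains Y (int j + 1)"
        using fin[of "insert x \<sigma>"] by (auto simp: cone_single chains_def)
    qed
    then show "star_part x (boundary (cone x c)) \<in> star_part x ` boundaries Y (int j)"
      by (auto simp: boundaries_def)
  qed
qed

text \<open>
  The rank of the augmented boundary map of \<open>L\<close> on simplices with \<open>j + 1\<close> vertices. In degree zero it
  is the augmentation to the field, of rank one as soon as there is a vertex.
\<close>

definition reduced_rk :: "'f::field itself \<Rightarrow> 'a set set \<Rightarrow> nat \<Rightarrow> nat" where
  "reduced_rk F L j = (if j = 0 then (if vertices L = {} then 0 else 1) else rk F L (int j - 1))"

text \<open>
  In positive degrees, boundaries containing \<open>x\<close> are the cones over the boundaries of the link. In
  degree zero they are multiples of \<open>x\<close>, and any edge at \<open>x\<close> provides a nonzero one.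
\<close>

lemma dim_star_part_boundaries:
  fixes F :: "'f::field itself" and Y :: "'a set set"
  assumes Y: "simplicial_complex Y"
  shows "chain.dim (star_part x ` boundaries Y (int j) :: ('a set \<Rightarrow>\<^sub>0 'f) set) = reduced_rk F (lk x Y) j"
proof (cases "j = 0")
  case False
  let ?L = "lk x Y"
  have fin: "finite \<sigma>" if "\<sigma> \<in> ?L" for \<sigma>
    using Y that by (auto simp: simplicial_complex_def lk_def)
  have finL: "finite ?L"
    by (rule finite_lk[OF Y])
  obtain T :: "('a set \<Rightarrow>\<^sub>0 'f) set" where T: "finite T" "chains ?L (int j) \<subseteq> chain.span T"
    using chains_spanned[OF finL] by blast
  have "star_part x ` (boundaries Y (int j) :: ('a set \<Rightarrow>\<^sub>0 'f) set) = cone x ` boundary ` chains ?L (int j)"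
    unfolding star_part_boundaries[OF Y] image_image
  proof (rule image_cong[OF refl])
    fix c :: "'a set \<Rightarrow>\<^sub>0 'f" assume "c \<in> chains ?L (int j)"
    then have "c \<in> supported {\<sigma>. finite \<sigma> \<and> x \<notin> \<sigma> \<and> 2 \<le> card \<sigma>}"
      using False fin by (fastforce simp: chains_def supported_def lk_def)
    then show "star_part x (boundary (cone x c)) = cone x (boundary c)"
      by (rule star_part_boundary_cone)
  qed
  also have "boundary ` chains ?L (int j) = (boundaries ?L (int j - 1) :: ('a set \<Rightarrow>\<^sub>0 'f) set)"
    by (simp add: boundaries_def)
  also have "chain.dim (cone x ` \<dots>) = chain.dim (boundaries ?L (int j - 1) :: ('a set \<Rightarrow>\<^sub>0 'f) set)"
  proof (rule chain.dim_injective_image[OF linear_cone subspace_boundaries])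
    show "boundaries ?L (int j - 1) \<subseteq> chain.span (boundary ` T)"
      using T(2) chain_pair.linear_span_image[OF linear_boundary, of T] by (auto simp: boundaries_def)
    show "finite (boundary ` T)"
      using T(1) by simp
    have "boundaries ?L (int j - 1) \<subseteq> (supported {\<sigma>. x \<notin> \<sigma>} :: ('a set \<Rightarrow>\<^sub>0 'f) set)"
    proof
      fix b :: "'a set \<Rightarrow>\<^sub>0 'f" assume "b \<in> boundaries ?L (int j - 1)"
      then obtain c where "b = boundary c" "c \<in> chains ?L (int j)"
        by (auto simp: boundaries_def)
      moreover from this have "c \<in> supported {\<sigma>. x \<notin> \<sigma>}"
        by (auto simp: chains_def supported_def lk_def)
      ultimately show "b \<in> supported {\<sigma>. x \<notin> \<sigma>}"
        using star_part_boundary_free star_part_eq_0_iff by metis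
    qed
    then show "inj_on (cone x) (boundaries ?L (int j - 1) :: ('a set \<Rightarrow>\<^sub>0 'f) set)"
      by (intro inj_on_inverseI[of _ "uncone x"] uncone_cone) auto
  qed
  finally show ?thesis
    using False by (simp add: reduced_rk_def rk_def)
next
  case True
  let ?L = "lk x Y"
  let ?V = "star_part x ` (boundaries Y 0 :: ('a set \<Rightarrow>\<^sub>0 'f) set)"
  have V: "?V = (\<lambda>c. star_part x (boundary (cone x c))) ` chains ?L 0"
    using star_part_boundaries[OF Y, of x 0] by simp
  have subV: "chain.subspace ?V"
    by (intro chain_pair.linear_subspace_image[OF linear_star_part] subspace_boundaries)
  have edge: "star_part x (boundary (cone x (face {v} :: 'a set \<Rightarrow>\<^sub>0 'f)))
      = Poly_Mapping.single {x} (cone_sign x {v} * incidence {x, v} v)" if "v \<noteq> x" for v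
    using star_part_boundary_cone_face[of "{v}" x, where 'f = 'f] that by simp
  show ?thesis
  proof (cases "vertices ?L = {}")
    case empty: True
    have none: "faces ?L 0 = {}"
      using empty by (auto simp: vertices_def)
    have "chains ?L 0 = {0 :: 'a set \<Rightarrow>\<^sub>0 'f}"
      unfolding chains_eq_supported none by (auto simp: supported_def)
    then have "?V = {0}"
      unfolding V by (simp add: chain_pair.linear_0[OF linear_cone]
          chain_pair.linear_0[OF linear_boundary] chain_pair.linear_0[OF linear_star_part])
    then show ?thesis
      using True empty by (simp add: reduced_rk_def chain.dim_zero_subspace)
  next
    case nonempty: False
    have ne: "face {x} \<noteq> (0 :: 'a set \<Rightarrow>\<^sub>0 'f)"
      by (metis lookup_single_eq lookup_zero zero_neq_one)
    obtain v \<sigma> where v: "v \<in> \<sigma>" "\<sigma> \<in> ?L"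
      using nonempty by (auto simp: vertices_def)
    then have "v \<noteq> x" "{x, v} \<in> Y"
      using complex_subset[OF Y, of "insert x \<sigma>" "{x, v}"] by (auto simp: lk_def)
    then have "(face {v} :: 'a set \<Rightarrow>\<^sub>0 'f) \<in> chains ?L 0"
      by (auto simp: chains_def lk_def)
    then have "star_part x (boundary (cone x (face {v} :: 'a set \<Rightarrow>\<^sub>0 'f))) \<in> ?V"
      unfolding V by blast
    moreover define a :: 'f where "a = cone_sign x {v} * incidence {x, v} v"
    ultimately have "Poly_Mapping.single {x} a \<in> ?V"
      by (simp add: edge[OF \<open>v \<noteq> x\<close>])
    moreover have "a \<noteq> 0"
      by (simp add: a_def cone_sign_nonzero incidence_nonzero)
    ultimately have "face {x} \<in> ?V"
      using chain.subspace_scale[OF subV, of "Poly_Mapping.single {x} a" "inverse a"]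
      by (simp add: cscale_single)
    moreover have "?V \<subseteq> chain.span {face {x}}"
    proof
      fix b assume "b \<in> ?V"
      then obtain c :: "'a set \<Rightarrow>\<^sub>0 'f" where c: "c \<in> chains ?L 0"
        "b = (star_part x \<circ> (boundary \<circ> cone x)) c"
        unfolding V by auto
      have "(star_part x \<circ> (boundary \<circ> cone x)) c \<in> chain.span {face {x}}"
      proof (rule linear_supported_image[where f = "star_part x \<circ> (boundary \<circ> cone x)"])
        show "chain_linear (star_part x \<circ> (boundary \<circ> cone x) :: ('a set \<Rightarrow>\<^sub>0 'f) \<Rightarrow> _)"
          by (intro chain_linear_compose linear_cone linear_boundary linear_star_part)
        show "c \<in> supported (faces ?L 0)"
          using c(1) by (simp add: chains_eq_supported)
        fix \<sigma> assume "\<sigma> \<in> faces ?L 0"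
        then obtain u where "\<sigma> = {u}" "u \<noteq> x"
          by (auto simp: lk_def card_1_singleton_iff)
        then show "(star_part x \<circ> (boundary \<circ> cone x)) (face \<sigma> :: 'a set \<Rightarrow>\<^sub>0 'f) \<in> chain.span {face {x}}"
          using chain.span_scale[OF chain.span_base, of "face {x} :: 'a set \<Rightarrow>\<^sub>0 'f" "{face {x}}"
              "cone_sign x {u} * incidence {x, u} u"]
          by (simp add: edge cscale_single)
      qed simp
      with c(2) show "b \<in> chain.span {face {x}}"
        by simp
    qed
    ultimately have "chain.dim ?V = 1"
      using ne by (intro chain.dim_unique[of "{face {x}}"]) auto
    then show ?thesis
      using True nonempty by (simp add: reduced_rk_def)
  qed
qed

text \<open>
  Rank-nullity for \<open>star_part x\<close> on the boundaries of \<open>Y\<close>: its image is the space of boundaries of the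
  augmented chain complex of the link, and its kernel consists of the boundaries that avoid \<open>x\<close>.
\<close>

lemma rk_remove_vertex:
  fixes F :: "'f::field itself" and Y :: "'a set set"
  assumes Y: "simplicial_complex Y"
  shows "rk F Y (int j) = reduced_rk F (lk x Y) j +
    chain.dim (boundaries Y (int j) \<inter> chains {\<sigma> \<in> Y. x \<notin> \<sigma>} (int j) :: ('a set \<Rightarrow>\<^sub>0 'f) set)"
proof -
  have "finite Y"
    using Y by (simp add: simplicial_complex_def)
  then obtain T :: "('a set \<Rightarrow>\<^sub>0 'f) set" where T: "finite T" "chains Y (int j) \<subseteq> chain.span T"
    using chains_spanned by blast
  have BC: "boundaries Y (int j) \<subseteq> (chains Y (int j) :: ('a set \<Rightarrow>\<^sub>0 'f) set)"
    using boundaries_subset_cycles[OF Y] by (auto simp: cycles_def)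
  have "{z \<in> boundaries Y (int j). star_part x z = (0 :: 'a set \<Rightarrow>\<^sub>0 'f)}
      = boundaries Y (int j) \<inter> chains {\<sigma> \<in> Y. x \<notin> \<sigma>} (int j)"
    using BC by (auto simp: star_part_eq_0_iff supported_def chains_def)
  then show ?thesis
    unfolding rk_def dim_star_part_boundaries[OF Y, of x j F, symmetric]
    using chain.rank_nullity[OF linear_star_part subspace_boundaries order_trans[OF BC T(2)] T(1), of x]
    by simp
qed

section \<open>Alternating sums\<close>

definition alt :: "(nat \<Rightarrow> real) \<Rightarrow> nat \<Rightarrow> real" where
  "alt f j = (\<Sum>i=0..j. (-1) ^ (j - i) * f i)"

lemma alt_0: "alt f 0 = f 0"
  by (simp add: alt_def)

lemma alt_Suc: "alt f (Suc j) = f (Suc j) - alt f j"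
proof -
  have "(\<Sum>i=0..j. (-1) ^ (Suc j - i) * f i) = (\<Sum>i=0..j. - ((-1) ^ (j - i) * f i))"
    by (rule sum.cong) (auto simp: Suc_diff_le)
  then show ?thesis
    by (simp add: alt_def sum_negf)
qed

lemma alt_diff: "alt (\<lambda>i. f i - g i) j = alt f j - alt g j"
  by (induction j) (simp_all add: alt_0 alt_Suc)

lemma alt_sum: "alt (\<lambda>i. \<Sum>x\<in>S. w x * f x i) j = (\<Sum>x\<in>S. w x * alt (f x) j)"
  by (induction j) (simp_all add: alt_0 alt_Suc sum_subtractf right_diff_distrib)

text \<open>
  This is how ranks disappear from alternating sums of Betti numbers: each rank is shared by two
  consecutive degrees.
\<close>

lemma alt_telescope: "alt (\<lambda>i. r i + (if i = 0 then 0 else r (i - 1))) j = r j"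
  by (induction j) (simp_all add: alt_0 alt_Suc)

section \<open>Induced subcomplexes and links\<close>

lemma simplicial_complex_induced:
  assumes "simplicial_complex X"
  shows "simplicial_complex (induced X A)"
  using assms unfolding simplicial_complex_def induced_def
  by (auto intro: finite_subset[of _ X])

lemma singleton_face: "simplicial_complex X \<Longrightarrow> x \<in> vertices X \<Longrightarrow> {x} \<in> X"
  by (auto simp: vertices_def intro: complex_subset)

lemma simplicial_complex_lk:
  assumes X: "simplicial_complex X" and x: "x \<in> vertices X"
  shows "simplicial_complex (lk x X)"
  unfolding simplicial_complex_def
proof (intro conjI ballI allI impI)
  show "finite (lk x X)"
    by (rule finite_lk[OF X])
  show "{} \<in> lk x X"
    using singleton_face[OF X x] by (simp add: lk_def)
next
  fix \<alpha> assume \<alpha>: "\<alpha> \<in> lk x X"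
  then show "finite \<alpha>"
    using X by (auto simp: simplicial_complex_def lk_def)
  fix \<beta> assume "\<beta> \<subseteq> \<alpha>"
  then show "\<beta> \<in> lk x X"
    using \<alpha> complex_subset[OF X, of "insert x \<alpha>" "insert x \<beta>"] by (auto simp: lk_def)
qed

lemma vertices_induced:
  assumes "simplicial_complex X" "A \<subseteq> vertices X"
  shows "vertices (induced X A) = A"
proof
  show "vertices (induced X A) \<subseteq> A"
    by (auto simp: vertices_def induced_def)
  show "A \<subseteq> vertices (induced X A)"
  proof
    fix x assume "x \<in> A"
    then have "{x} \<in> induced X A"
      using singleton_face[OF assms(1)] assms(2) by (auto simp: induced_def)
    then show "x \<in> vertices (induced X A)"
      by (auto simp: vertices_def)
  qed
qed

lemma induced_Int_vertices: "induced X (A \<inter> vertices X) = induced X A"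
  by (auto simp: induced_def vertices_def)

lemma induced_vertices: "induced X (vertices X) = X"
  by (auto simp: induced_def vertices_def)

lemma induced_subset: "induced X A \<subseteq> X"
  by (auto simp: induced_def)

lemma finite_vertices: "simplicial_complex X \<Longrightarrow> finite (vertices X)"
  by (auto simp: vertices_def simplicial_complex_def)

lemma lk_induced: "x \<notin> A \<Longrightarrow> lk x (induced X (insert x A)) = induced (lk x X) A"
  by (auto simp: lk_def induced_def)

lemma induced_remove: "x \<notin> A \<Longrightarrow> {\<sigma> \<in> induced X (insert x A). x \<notin> \<sigma>} = induced X A"
  by (auto simp: induced_def)

section \<open>Relative Betti numbers\<close>

text \<open>
  The dimension of the degree \<open>i\<close> homology of a cone over \<open>L\<close> relative to \<open>L\<close>, that is, of the
  degree \<open>i - 1\<close> homology of the augmented chain complex of \<open>L\<close>. That complex starts with the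
  empty face, so that \<open>{{}}\<close> has a class in degree \<open>i = 0\<close>.
\<close>

definition rel_betti :: "'f::field itself \<Rightarrow> 'a set set \<Rightarrow> nat \<Rightarrow> real" where
  "rel_betti F L i = real (card {\<sigma> \<in> L. card \<sigma> = i})
     - (real (reduced_rk F L i) + (if i = 0 then 0 else real (reduced_rk F L (i - 1))))"

lemma alt_rel_betti:
  "alt (rel_betti F L) j = alt (\<lambda>i. real (card {\<sigma> \<in> L. card \<sigma> = i})) j - real (reduced_rk F L j)"
  using alt_telescope[of "\<lambda>i. real (reduced_rk F L i)" j]
  by (simp add: rel_betti_def[abs_def] alt_diff)

lemma rk_neg: 
  assumes "simplicial_complex X"
  shows "rk F X (- 1) = 0"
proof -
  have none: "faces X (- 1) = {}"
    using assms by (auto simp: simplicial_complex_def)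
  show ?thesis
    using betti_ranks[OF assms, of F "-1"] unfolding none by simp
qed

lemma real_betti:
  assumes "simplicial_complex X"
  shows "real (betti F X (int i)) = real (card (faces X (int i)))
    - (real (rk F X (int i)) + (if i = 0 then 0 else real (rk F X (int (i - 1)))))"
  using betti_ranks[OF assms, of F "int i"] rk_neg[OF assms, of F]
  by (auto simp: of_nat_diff simp flip: of_nat_add)

lemma alt_betti:
  assumes "simplicial_complex X"
  shows "alt (\<lambda>i. real (betti F X (int i))) j
    = alt (\<lambda>i. real (card (faces X (int i)))) j - real (rk F X (int j))"
  using alt_telescope[of "\<lambda>i. real (rk F X (int i))" j]
  by (simp add: real_betti[OF assms] alt_diff)

lemma rel_betti_0:
  assumes "simplicial_complex L"
  shows "rel_betti F L 0 = (if vertices L = {} then 1 else 0)"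
proof -
  have "{\<sigma> \<in> L. card \<sigma> = 0} = {{}}"
    using assms by (auto simp: simplicial_complex_def)
  then show ?thesis
    by (simp add: rel_betti_def reduced_rk_def)
qed

text \<open>
  The reduced Betti number of \<open>{{}}\<close> in degree zero is \<open>-1\<close> by convention, where the augmented
  complex has no homology. The Kronecker symbol in the mu-vector makes up for this.
\<close>

lemma rel_betti_Suc:
  assumes L: "simplicial_complex L"
  shows "rel_betti F L (Suc i) =
    real_of_int (reduced_betti F L (int i)) + (if i = 0 \<and> vertices L = {} then 1 else 0)"
proof -
  have "faces L (int i) = {\<sigma> \<in> L. card \<sigma> = Suc i}"
    by auto
  then show ?thesis
    using real_betti[OF L, of F i]
    by (cases i) (simp_all add: rel_betti_def reduced_rk_def reduced_betti_def)
qed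

text \<open>
  The binomial coefficients in the sigma-vector, together with the denominator in the mu-vector, are
  the probabilities that the vertices of the link before \<open>x\<close> are those of \<open>B\<close>.
\<close>

lemma mu_summand:
  assumes L: "simplicial_complex L"
  shows "(if i = 0 then 1 else (if i = 1 then 1 else 0) + sigma F L (int i - 1)) / (1 + real (f0 L))
    = (\<Sum>B\<in>Pow (vertices L). weight (f0 L) (card B) * rel_betti F (induced L B) i)"
proof -
  let ?V = "vertices L" and ?m = "f0 L"
  have fin: "finite ?V"
    by (rule finite_vertices[OF L])
  have w: "weight ?m (card B) = 1 / ((1 + real ?m) * real (?m choose card B))" if "B \<in> Pow ?V" for B
    using that fin by (intro weight_binomial) (auto simp: f0_def card_mono)
  have empty: "(\<Sum>B\<in>Pow ?V. weight ?m (card B) * (if B = {} then 1 else 0)) = 1 / (1 + real ?m)"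
    using fin by (simp add: if_distrib[of "(*) _"] sum.delta w cong: if_cong)
  have vert: "vertices (induced L B) = B" if "B \<in> Pow ?V" for B
    using that vertices_induced[OF L] by auto
  note ind = simplicial_complex_induced[OF L]
  show ?thesis
  proof (cases i)
    case 0
    have "(\<Sum>B\<in>Pow ?V. weight ?m (card B) * rel_betti F (induced L B) 0)
        = (\<Sum>B\<in>Pow ?V. weight ?m (card B) * (if B = {} then 1 else 0))"
      by (intro sum.cong refl) (simp add: rel_betti_0[OF ind] vert)
    then show ?thesis
      using 0 empty by simp
  next
    case (Suc k)
    have "(\<Sum>B\<in>Pow ?V. weight ?m (card B) * rel_betti F (induced L B) i)
        = (\<Sum>B\<in>Pow ?V. weight ?m (card B) * real_of_int (reduced_betti F (induced L B) (int k))
            + (if k = 0 then 1 else 0) * (weight ?m (card B) * (if B = {} then 1 else 0)))"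
      by (intro sum.cong refl) (simp add: Suc rel_betti_Suc[OF ind] vert distrib_left)
    also have "\<dots> = (\<Sum>B\<in>Pow ?V. weight ?m (card B) * real_of_int (reduced_betti F (induced L B) (int k)))
        + (if k = 0 then 1 else 0) / (1 + real ?m)"
      unfolding sum.distrib sum_distrib_left[symmetric] empty by simp
    also have "(\<Sum>B\<in>Pow ?V. weight ?m (card B) * real_of_int (reduced_betti F (induced L B) (int k)))
        = (\<Sum>B\<in>Pow ?V. real_of_int (reduced_betti F (induced L B) (int k)) / real (?m choose card B))
            / (1 + real ?m)"
      unfolding sum_divide_distrib by (intro sum.cong refl) (simp add: w)
    also have "(\<Sum>B\<in>Pow ?V. real_of_int (reduced_betti F (induced L B) (int k)) / real (?m choose card B))
        = sigma F L (int k)"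
    proof (cases "int k > max 0 (dimension L)")
      case True
      \<comment> \<open>Above the dimension the convention \<open>\<sigma>\<^sub>k = 0\<close> agrees with the sum; here \<open>k > 0\<close>, so that
        reduced Betti numbers are Betti numbers.\<close>
      have "reduced_betti F (induced L B) (int k) = 0" for B
      proof -
        have "card \<sigma> \<le> Max (card ` L)" if "\<sigma> \<in> L" for \<sigma>
          using L that by (intro Max_ge) (auto simp: simplicial_complex_def)
        then have none: "faces (induced L B) (int k) = {}"
          using True by (fastforce simp: dimension_def induced_def)
        have "betti F (induced L B) (int k) = 0"
          using betti_ranks[OF ind, of F B "int k"] unfolding none by simp
        then show ?thesis
          using True by (simp add: reduced_betti_def)
      qed
      then show ?thesis
        using True by (simp add: sigma_def)
    next
      case False
      then show ?thesis
        by (auto simp: sigma_def)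
    qed
    finally show ?thesis
      unfolding Suc by (simp add: add_divide_distrib)
  qed
qed

text \<open>
  The mu-vector counts, on average over the orders of all vertices, the relative classes created when
  a vertex \<open>x\<close> is added to the set \<open>A\<close> of its predecessors. Each link has its own vertex set in the
  definition; \<open>weight_sum_Int\<close> lets all of them use orders of the vertices of \<open>X\<close>.
\<close>

lemma mu_eq_weighted_sum:
  assumes X: "simplicial_complex X"
  shows "mu F X i = (\<Sum>x\<in>vertices X. \<Sum>A\<in>Pow (vertices X - {x}).
    weight (card (vertices X) - 1) (card A) * rel_betti F (lk x (induced X (insert x A))) i)"
proof -
  have "mu F X i = (\<Sum>x\<in>vertices X.
      (if i = 0 then 1 else (if i = 1 then 1 else 0) + sigma F (lk x X) (int i - 1)) / (1 + real (f0 (lk x X))))"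
    by (simp add: mu_def)
  also have "\<dots> = (\<Sum>x\<in>vertices X. \<Sum>A\<in>Pow (vertices X - {x}).
    weight (card (vertices X) - 1) (card A) * rel_betti F (lk x (induced X (insert x A))) i)"
  proof (rule sum.cong[OF refl])
    fix x assume x: "x \<in> vertices X"
    let ?L = "lk x X" and ?W = "vertices X - {x}"
    have L: "simplicial_complex ?L"
      by (rule simplicial_complex_lk[OF X x])
    have sub: "vertices ?L \<subseteq> ?W"
      by (auto simp: vertices_def lk_def)
    have "(if i = 0 then 1 else (if i = 1 then 1 else 0) + sigma F ?L (int i - 1)) / (1 + real (f0 ?L))
        = (\<Sum>B\<in>Pow (vertices ?L). weight (card (vertices ?L)) (card B) * rel_betti F (induced ?L B) i)"
      unfolding mu_summand[OF L] by (simp add: f0_def)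
    also have "\<dots> = (\<Sum>A\<in>Pow (vertices ?L \<union> (?W - vertices ?L)).
        weight (card (vertices ?L \<union> (?W - vertices ?L))) (card A) * rel_betti F (induced ?L (A \<inter> vertices ?L)) i)"
      using finite_vertices[OF X] finite_vertices[OF L] by (intro weight_sum_Int[symmetric]) auto
    also have "vertices ?L \<union> (?W - vertices ?L) = ?W"
      using sub by auto
    also have "(\<Sum>A\<in>Pow ?W. weight (card ?W) (card A) * rel_betti F (induced ?L (A \<inter> vertices ?L)) i)
      = (\<Sum>A\<in>Pow ?W. weight (card (vertices X) - 1) (card A) * rel_betti F (lk x (induced X (insert x A))) i)"
    proof (rule sum.cong[OF refl])
      fix A assume "A \<in> Pow ?W"
      then have "lk x (induced X (insert x A)) = induced ?L A"
        by (intro lk_induced) auto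
      then show "weight (card ?W) (card A) * rel_betti F (induced ?L (A \<inter> vertices ?L)) i
        = weight (card (vertices X) - 1) (card A) * rel_betti F (lk x (induced X (insert x A))) i"
        using x finite_vertices[OF X] by (simp add: induced_Int_vertices)
    qed
    finally show "(if i = 0 then 1 else (if i = 1 then 1 else 0) + sigma F ?L (int i - 1)) / (1 + real (f0 ?L))
      = (\<Sum>A\<in>Pow ?W. weight (card (vertices X) - 1) (card A) * rel_betti F (lk x (induced X (insert x A))) i)" .
  qed
  finally show ?thesis .
qed

section \<open>The Morse relations\<close>

text \<open>
  The dimension of the kernel of \<open>H\<^sub>j(X[A]) \<rightarrow> H\<^sub>j(X[A \<union> {x}])\<close>: boundaries of the larger complex
  that lie in the smaller one, modulo the boundaries of the smaller one.
\<close>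

definition excess :: "'f::field itself \<Rightarrow> 'a set set \<Rightarrow> nat \<Rightarrow> 'a \<Rightarrow> 'a set \<Rightarrow> real" where
  "excess F X j x A =
     real (chain.dim (boundaries (induced X (insert x A)) (int j) \<inter> chains (induced X A) (int j)
       :: ('a set \<Rightarrow>\<^sub>0 'f) set)) - real (rk F (induced X A) (int j))"

lemma card_faces_remove_vertex:
  assumes Y: "simplicial_complex Y"
  shows "card (faces Y (int i)) = card (faces {\<sigma> \<in> Y. x \<notin> \<sigma>} (int i)) + card {\<sigma> \<in> lk x Y. card \<sigma> = i}"
proof -
  let ?S = "{\<sigma> \<in> faces Y (int i). x \<in> \<sigma>}" and ?D = "faces {\<sigma> \<in> Y. x \<notin> \<sigma>} (int i)"
  have fin: "finite Y" "\<And>\<sigma>. \<sigma> \<in> Y \<Longrightarrow> finite \<sigma>"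
    using Y by (auto simp: simplicial_complex_def)
  have "card (?D \<union> ?S) = card ?D + card ?S"
    using fin(1) by (intro card_Un_disjoint) auto
  moreover have "?D \<union> ?S = faces Y (int i)"
    by auto
  moreover have "card ?S = card {\<sigma> \<in> lk x Y. card \<sigma> = i}"
  proof (rule bij_betw_same_card, rule bij_betw_byWitness[where f' = "insert x"])
    show "(\<lambda>\<sigma>. \<sigma> - {x}) ` ?S \<subseteq> {\<sigma> \<in> lk x Y. card \<sigma> = i}"
      using fin(2) by (auto simp: lk_def insert_absorb)
    show "insert x ` {\<sigma> \<in> lk x Y. card \<sigma> = i} \<subseteq> ?S"
    proof
      fix \<tau> assume "\<tau> \<in> insert x ` {\<sigma> \<in> lk x Y. card \<sigma> = i}"
      then obtain \<sigma> where "\<tau> = insert x \<sigma>" "x \<notin> \<sigma>" "insert x \<sigma> \<in> Y" "card \<sigma> = i"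
        by (auto simp: lk_def)
      then show "\<tau> \<in> ?S"
        using fin(2)[of \<tau>] by auto
    qed
  qed (auto simp: lk_def)
  ultimately show ?thesis
    by argo
qed

text \<open>
  The long exact sequence of the pair \<open>(X[A \<union> {x}], X[A])\<close>, truncated at degree \<open>j\<close>: the alternating
  sums of the Betti numbers of the pair and of both complexes would cancel, were it not for the kernel
  at the point of truncation.
\<close>

lemma excess_eq:
  assumes X: "simplicial_complex X" and x: "x \<notin> A"
  shows "excess F X j x A = alt (rel_betti F (lk x (induced X (insert x A)))) j
    - (alt (\<lambda>i. real (betti F (induced X (insert x A)) (int i))) j
       - alt (\<lambda>i. real (betti F (induced X A) (int i))) j)"
proof -
  let ?Y = "induced X (insert x A)" and ?Z = "induced X A"
  have Y: "simplicial_complex ?Y" and Z: "simplicial_complex ?Z"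
    by (rule simplicial_complex_induced[OF X])+
  have "alt (\<lambda>i. real (card (faces ?Y (int i)))) j - alt (\<lambda>i. real (card (faces ?Z (int i)))) j
      = alt (\<lambda>i. real (card {\<sigma> \<in> lk x ?Y. card \<sigma> = i})) j"
    unfolding alt_diff[symmetric] card_faces_remove_vertex[OF Y, of _ x] induced_remove[OF x] by simp
  then show ?thesis
    using rk_remove_vertex[OF Y, of F j x]
    by (simp add: excess_def alt_rel_betti alt_betti[OF Y] alt_betti[OF Z] induced_remove[OF x])
qed

text \<open>
  The average of \<open>excess_eq\<close>: the alternating sums for \<open>X[A]\<close> telescope from the empty
  complex to \<open>X\<close>.
\<close>

lemma alt_mu_minus_alt_betti:
  fixes X :: "'a set set"
  assumes X: "simplicial_complex X"
  shows "alt (mu F X) j - alt (\<lambda>i. real (betti F X (int i))) j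
    = (\<Sum>x\<in>vertices X. \<Sum>A\<in>Pow (vertices X - {x}).
        weight (card (vertices X) - 1) (card A) * excess F X j x A)"
proof -
  let ?V = "vertices X"
  define w where "w A = weight (card ?V - 1) (card A)" for A :: "'a set"
  define g where "g A = alt (\<lambda>i. real (betti F (induced X A) (int i))) j" for A
  have "betti F (induced X {}) (int i) = 0" for i
  proof -
    have none: "faces (induced X {}) (int i) = {}"
      by (auto simp: induced_def)
    show ?thesis
      using betti_ranks[OF simplicial_complex_induced[OF X], of F "{}" "int i"] unfolding none by simp
  qed
  then have g0: "g {} = 0"
    by (simp add: g_def alt_def)
  have gV: "g ?V = alt (\<lambda>i. real (betti F X (int i))) j"
    by (simp add: g_def induced_vertices)
  have "alt (mu F X) j = alt (\<lambda>i. \<Sum>x\<in>?V. 1 * (\<Sum>A\<in>Pow (?V - {x}). w A * rel_betti F (lk x (induced X (insert x A))) i)) j"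
    unfolding w_def by (simp add: mu_eq_weighted_sum[OF X, abs_def] cong: if_cong)
  also have "\<dots> = (\<Sum>x\<in>?V. \<Sum>A\<in>Pow (?V - {x}). w A * alt (rel_betti F (lk x (induced X (insert x A)))) j)"
    unfolding alt_sum by simp
  also have "\<dots> - (\<Sum>x\<in>?V. \<Sum>A\<in>Pow (?V - {x}). w A * (g (insert x A) - g A))
    = (\<Sum>x\<in>?V. \<Sum>A\<in>Pow (?V - {x}). w A * excess F X j x A)"
    unfolding sum_subtractf[symmetric] right_diff_distrib[symmetric]
  proof (intro sum.cong refl)
    fix x A assume "A \<in> Pow (?V - {x})"
    then have "x \<notin> A"
      by auto
    then show "w A * (alt (rel_betti F (lk x (induced X (insert x A)))) j - (g (insert x A) - g A))
        = w A * excess F X j x A"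
      by (simp add: excess_eq[OF X] g_def)
  qed
  also have "(\<Sum>x\<in>?V. \<Sum>A\<in>Pow (?V - {x}). w A * (g (insert x A) - g A)) = g ?V - g {}"
    unfolding w_def by (rule weight_sum_increments[OF finite_vertices[OF X]])
  finally show ?thesis
    unfolding g0 gV w_def by simp
qed

lemma
  fixes F :: "'f::field itself" and X :: "'a set set"
  assumes X: "simplicial_complex X"
  shows excess_nonneg: "excess F X j x A \<ge> 0"
    and excess_eq_0_iff: "excess F X j x A = 0 \<longleftrightarrow>
      boundaries (induced X (insert x A)) (int j) \<inter> chains (induced X A) (int j)
        \<subseteq> (boundaries (induced X A) (int j) :: ('a set \<Rightarrow>\<^sub>0 'f) set)"
proof -
  let ?Y = "induced X (insert x A)" and ?Z = "induced X A"
  let ?B = "boundaries ?Z (int j) :: ('a set \<Rightarrow>\<^sub>0 'f) set"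
  let ?C = "boundaries ?Y (int j) \<inter> chains ?Z (int j) :: ('a set \<Rightarrow>\<^sub>0 'f) set"
  have Z: "simplicial_complex ?Z"
    by (rule simplicial_complex_induced[OF X])
  then have "finite ?Z"
    by (simp add: simplicial_complex_def)
  then obtain T :: "('a set \<Rightarrow>\<^sub>0 'f) set" where T: "finite T" "chains ?Z (int j) \<subseteq> chain.span T"
    using chains_spanned by blast
  have "?B \<subseteq> boundaries ?Y (int j)"
    by (rule boundaries_mono) (auto simp: induced_def)
  moreover have "?B \<subseteq> cycles ?Z (int j)"
    by (rule boundaries_subset_cycles[OF Z])
  ultimately have BC: "?B \<subseteq> ?C"
    by (auto simp: cycles_def)
  have C: "chain.subspace ?C"
    by (intro chain.subspace_inter subspace_boundaries subspace_chains)
  have CT: "?C \<subseteq> chain.span T"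
    using T(2) by blast
  note dims = chain.subspace_dim_mono[OF subspace_boundaries BC C CT T(1)]
  show "excess F X j x A \<ge> 0"
    using dims(1) by (simp add: excess_def rk_def)
  show "excess F X j x A = 0 \<longleftrightarrow> ?C \<subseteq> ?B"
    using dims(2) BC by (auto simp: excess_def rk_def)
qed

lemma alt_betti_le_alt_mu:
  assumes X: "simplicial_complex X"
  shows "alt (\<lambda>i. real (betti F X (int i))) j \<le> alt (mu F X) j"
proof -
  have "0 \<le> (\<Sum>x\<in>vertices X. \<Sum>A\<in>Pow (vertices X - {x}).
        weight (card (vertices X) - 1) (card A) * excess F X j x A)"
    by (intro sum_nonneg mult_nonneg_nonneg excess_nonneg[OF X] less_imp_le[OF weight_pos])
  then show ?thesis
    using alt_mu_minus_alt_betti[OF X, of F j] by simp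
qed

text \<open>
  Every pair \<open>(x, A)\<close> has positive weight, so equality means that every inclusion adding a single
  vertex is injective in degree \<open>j\<close>. Compositions then give injectivity into \<open>X\<close>, and conversely a
  map that stays injective after composition is injective.
\<close>

lemma alt_mu_eq_alt_betti_iff:
  fixes F :: "'f::field itself" and X :: "'a set set"
  assumes X: "simplicial_complex X"
  shows "alt (mu F X) j = alt (\<lambda>i. real (betti F X (int i))) j \<longleftrightarrow>
    (\<forall>A. inj_on (inclusion_hom X (int j)) (homology (induced X A) (int j) :: ('a set \<Rightarrow>\<^sub>0 'f) set set))"
    (is "?L \<longleftrightarrow> ?R")
proof -
  let ?V = "vertices X" and ?B = "\<lambda>A. boundaries (induced X A) (int j) :: ('a set \<Rightarrow>\<^sub>0 'f) set"
  let ?C = "\<lambda>A. chains (induced X A) (int j) :: ('a set \<Rightarrow>\<^sub>0 'f) set"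
  have fin: "finite ?V"
    by (rule finite_vertices[OF X])
  have "?L \<longleftrightarrow> (\<Sum>x\<in>?V. \<Sum>A\<in>Pow (?V - {x}). weight (card ?V - 1) (card A) * excess F X j x A) = 0"
    using alt_mu_minus_alt_betti[OF X, of F j] by auto
  also have "\<dots> \<longleftrightarrow> (\<forall>x\<in>?V. \<forall>A\<in>Pow (?V - {x}). weight (card ?V - 1) (card A) * excess F X j x A = 0)"
    using fin by (subst sum_nonneg_eq_0_iff, simp,
      intro sum_nonneg mult_nonneg_nonneg excess_nonneg[OF X] less_imp_le[OF weight_pos],
      intro ball_cong refl sum_nonneg_eq_0_iff)
      (auto intro!: mult_nonneg_nonneg excess_nonneg[OF X] less_imp_le[OF weight_pos])
  also have "\<dots> \<longleftrightarrow> (\<forall>x\<in>?V. \<forall>A\<in>Pow (?V - {x}). ?B (insert x A) \<inter> ?C A \<subseteq> ?B A)"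
    using weight_pos[THEN less_imp_neq, symmetric] by (simp add: excess_eq_0_iff[OF X])
  also have "\<dots> \<longleftrightarrow> (\<forall>A. boundaries X (int j) \<inter> ?C A \<subseteq> ?B A)"
  proof
    assume steps: "\<forall>x\<in>?V. \<forall>A\<in>Pow (?V - {x}). ?B (insert x A) \<inter> ?C A \<subseteq> ?B A"
    \<comment> \<open>Induction on the number of missing vertices: a boundary of \<open>X\<close> supported on \<open>A\<close> is first seen
      to bound after adding \<open>x\<close>, and then without it.\<close>
    have main: "boundaries X (int j) \<inter> ?C A \<subseteq> ?B A" if "A \<subseteq> ?V" for A
      using that
    proof (induction "card (?V - A)" arbitrary: A)
      case 0
      then have "A = ?V"
        using fin by auto
      then show ?case
        by (simp add: induced_vertices)
    next
      case (Suc k)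
      then obtain x where x: "x \<in> ?V - A"
        by (metis card.empty ex_in_conv nat.distinct(1))
      have e: "?V - insert x A = ?V - A - {x}"
        by auto
      have "k = card (?V - insert x A)"
        unfolding e card_Diff_singleton[OF x] using Suc(2) by linarith
      then have "boundaries X (int j) \<inter> ?C (insert x A) \<subseteq> ?B (insert x A)"
        by (rule Suc(1)) (use Suc(3) x in auto)
      moreover have "?C A \<subseteq> ?C (insert x A)"
        by (intro chains_mono) (auto simp: induced_def)
      moreover have "?B (insert x A) \<inter> ?C A \<subseteq> ?B A"
        using steps x Suc(3) by auto
      ultimately show ?case
        by blast
    qed
    show "\<forall>A. boundaries X (int j) \<inter> ?C A \<subseteq> ?B A"
    proof
      fix A
      show "boundaries X (int j) \<inter> ?C A \<subseteq> ?B A"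
        using main[of "A \<inter> ?V"] by (simp add: induced_Int_vertices)
    qed
  next
    assume "\<forall>A. boundaries X (int j) \<inter> ?C A \<subseteq> ?B A"
    moreover have "?B A \<subseteq> boundaries X (int j)" for A
      by (intro boundaries_mono) (auto simp: induced_def)
    ultimately show "\<forall>x\<in>?V. \<forall>A\<in>Pow (?V - {x}). ?B (insert x A) \<inter> ?C A \<subseteq> ?B A"
      by blast
  qed
  also have "\<dots> \<longleftrightarrow> ?R"
    using inj_on_inclusion_hom_iff[OF X simplicial_complex_induced[OF X], of _ "int j", where 'f = 'f]
    by (auto simp: induced_def)
  finally show ?thesis .
qed

lemma chains_eq_zero:
  assumes "faces X i = {}"
  shows "chains X i = {0}"
  unfolding chains_eq_supported assms by (auto simp: supported_def)

text \<open>
  The only boundary in the top degree is zero.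
\<close>

lemma inj_on_inclusion_hom_top:
  assumes X: "simplicial_complex X"
  shows "inj_on (inclusion_hom X (dimension X))
    (homology (induced X A) (dimension X) :: ('a set \<Rightarrow>\<^sub>0 'f::field) set set)"
proof -
  have "card \<sigma> \<le> Max (card ` X)" if "\<sigma> \<in> X" for \<sigma>
    using X that by (intro Max_ge) (auto simp: simplicial_complex_def)
  then have "faces X (dimension X + 1) = {}"
    by (fastforce simp: dimension_def)
  then have "boundaries X (dimension X) = {0 :: 'a set \<Rightarrow>\<^sub>0 'f}"
    unfolding boundaries_def by (simp add: chains_eq_zero chain_pair.linear_0[OF linear_boundary])
  then show ?thesis
    unfolding inj_on_inclusion_hom_iff[OF X simplicial_complex_induced[OF X] induced_subset]
    using chain.subspace_0[OF subspace_boundaries] by auto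
qed

lemma inj_on_inclusion_hom_neg:
  assumes X: "simplicial_complex X"
  shows "inj_on (inclusion_hom X (- 1)) (homology (induced X A) (- 1) :: ('a set \<Rightarrow>\<^sub>0 'f::field) set set)"
proof -
  have "faces (induced X A) (- 1) = {}"
    using X by (auto simp: simplicial_complex_def induced_def)
  then have "chains (induced X A) (- 1) = {0 :: 'a set \<Rightarrow>\<^sub>0 'f}"
    by (rule chains_eq_zero)
  then show ?thesis
    unfolding inj_on_inclusion_hom_iff[OF X simplicial_complex_induced[OF X] induced_subset]
    using chain.subspace_0[OF subspace_boundaries] by auto
qed

theorem theorem1p7:
  fixes F :: "'f::field itself" and X :: "'a set set" and d :: int
  assumes "simplicial_complex X" and "dimension X = d"
  shows
    "(\<forall>j::nat. int j \<le> d \<longrightarrow>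
        (\<Sum>i=0..j. (-1) ^ (j - i) * mu F X i)
          \<ge> (\<Sum>i=0..j. (-1) ^ (j - i) * real (betti F X (int i))))
     \<and> (\<forall>j::nat. int j = d \<longrightarrow>
        (\<Sum>i=0..j. (-1) ^ (j - i) * mu F X i)
          = (\<Sum>i=0..j. (-1) ^ (j - i) * real (betti F X (int i))))
     \<and> (\<forall>j::nat. int j \<le> d \<longrightarrow>
        ((\<Sum>i=0..j. (-1) ^ (j - i) * mu F X i)
          = (\<Sum>i=0..j. (-1) ^ (j - i) * real (betti F X (int i)))
         \<longleftrightarrow>
         (\<forall>A :: 'a set.
            inj_on (inclusion_hom X (int j))
              (homology (induced X A) (int j) :: ('a set \<Rightarrow>\<^sub>0 'f) set set))))
     \<and> (\<forall>j::nat. int j \<le> d \<longrightarrow> mu F X j \<ge> real (betti F X (int j)))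
     \<and> (\<forall>j::nat. int j \<le> d \<longrightarrow>
        (mu F X j = real (betti F X (int j))
         \<longleftrightarrow>
         (\<forall>A :: 'a set.
            inj_on (inclusion_hom X (int j - 1))
              (homology (induced X A) (int j - 1) :: ('a set \<Rightarrow>\<^sub>0 'f) set set)
            \<and> inj_on (inclusion_hom X (int j))
              (homology (induced X A) (int j) :: ('a set \<Rightarrow>\<^sub>0 'f) set set))))"
proof -
  let ?\<beta> = "\<lambda>i. real (betti F X (int i))"
  let ?inj = "\<lambda>i. \<forall>A. inj_on (inclusion_hom X i) (homology (induced X A) i :: ('a set \<Rightarrow>\<^sub>0 'f) set set)"
  note le = alt_betti_le_alt_mu[OF assms(1), of F]
  note eq = alt_mu_eq_alt_betti_iff[OF assms(1), of F]
  have top: "alt (mu F X) j = alt ?\<beta> j" if "int j = d" for j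
    using inj_on_inclusion_hom_top[OF assms(1), where 'f = 'f] that assms(2) by (simp add: eq)
  have mu: "?\<beta> j \<le> mu F X j \<and> (mu F X j = ?\<beta> j \<longleftrightarrow> ?inj (int j - 1) \<and> ?inj (int j))" for j
  proof (cases j)
    case 0
    then show ?thesis
      using le[of 0] eq[of 0] inj_on_inclusion_hom_neg[OF assms(1), where 'f = 'f]
      by (simp add: alt_0)
  next
    case (Suc k)
    \<comment> \<open>The alternating sums up to \<open>j\<close> and up to \<open>j - 1\<close> add up to the term of index \<open>j\<close>, so both
      relations are strengthened together.\<close>
    have "mu F X j = alt (mu F X) j + alt (mu F X) k" "?\<beta> j = alt ?\<beta> j + alt ?\<beta> k"
      unfolding Suc alt_Suc by simp_all
    moreover have "int j - 1 = int k"
      using Suc by simp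
    ultimately show ?thesis
      using le[of j] le[of k] eq[of j] eq[of k] by auto
  qed
  show ?thesis
    unfolding alt_def[symmetric] using le eq top mu by blast
qed

end
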